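(* Let $m\ge 1$ be an integer and let $a_i,b_i,c_i\in\mathbb R$ for $i=0,\dots,m$. Consider the differential equation $$\frac{dx}{dt}=\sum_{i=0}^m\big(a_i+b_i\cos(2\pi t)+c_i\sin(2\pi t)\big)x^i,\qquad t\in[0,1],$$ and let $f_a(x)=\sum_{i=0}^m a_ix^i$, $f_b(x)=\sum_{i=0}^m b_ix^i$, $f_c(x)=\sum_{i=0}^m c_ix^i$. Suppose that there exist $m$ real zeros $\kappa_1<\cdots<\kappa_m$ of $f_a^2(x)-f_b^2(x)-f_c^2(x)$ such that either $(-1)^i f_a(\kappa_i)\ge 0$ for all $i=1,\dots,m$, or $(-1)^i f_a(\kappa_i)\le 0$ for all $i=1,\dots,m$. Then the differential equation has at most $m$ isolated periodic solutions, counted with multiplicities.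
   Context: Here $x\in\mathbb R$. A solution $x(t)$ is called a periodic solution if it is defined on all of $[0,1]$ and $x(0)=x(1)$. Let $x(t,x_0)$ denote the solution with $x(0,x_0)=x_0$, and let $H(x_0)=x(1,x_0)$ be the return map, defined for those $x_0$ whose solution exists on $[0,1]$. Periodic solutions correspond to zeros of $H(x_0)-x_0$; a periodic solution $x(t,x_0)$ is isolated if $x_0$ is an isolated zero of $H(\cdot)-\mathrm{id}$, and its multiplicity is the order of that zero. *)

theory Defs
  imports "HOL-Analysis.Analysis"
begin

text \<open>Scalar equations x' = F t x on the time interval [0,1].\<close>

definition ode_solution :: "(real \<Rightarrow> real \<Rightarrow> real) \<Rightarrow> (real \<Rightarrow> real) \<Rightarrow> bool" where
  "ode_solution F x \<longleftrightarrow>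
     (\<forall>t\<in>{0..1}. (x has_real_derivative F t (x t)) (at t within {0..1}))"

definition periodic_solution :: "(real \<Rightarrow> real \<Rightarrow> real) \<Rightarrow> (real \<Rightarrow> real) \<Rightarrow> bool" where
  "periodic_solution F x \<longleftrightarrow> ode_solution F x \<and> x 0 = x 1"

definition return_domain :: "(real \<Rightarrow> real \<Rightarrow> real) \<Rightarrow> real set" where
  "return_domain F = {x0. \<exists>x. ode_solution F x \<and> x 0 = x0}"

text \<open>
  The return map is meaningful only on the return domain, and for fields F for which initial
  value problems have unique solutions (such as fields continuous in t and polynomial in x).
\<close>

definition return_map :: "(real \<Rightarrow> real \<Rightarrow> real) \<Rightarrow> real \<Rightarrow> real" where
  "return_map F x0 = (THE y. \<exists>x. ode_solution F x \<and> x 0 = x0 \<and> x 1 = y)"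

definition displacement :: "(real \<Rightarrow> real \<Rightarrow> real) \<Rightarrow> real \<Rightarrow> real" where
  "displacement F x0 = return_map F x0 - x0"

definition isolated_periodic_solution ::
    "(real \<Rightarrow> real \<Rightarrow> real) \<Rightarrow> (real \<Rightarrow> real) \<Rightarrow> bool" where
  "isolated_periodic_solution F x \<longleftrightarrow>
     periodic_solution F x \<and> x 0 isolated_in {x0 \<in> return_domain F. displacement F x0 = 0}"

text \<open>
  A function is an element of \<open>real \<Rightarrow> real\<close>, whose values outside [0,1] are irrelevant here;
  isolated periodic solutions are therefore counted through their initial values.
\<close>

definition isolated_periodic_initials :: "(real \<Rightarrow> real \<Rightarrow> real) \<Rightarrow> real set" where
  "isolated_periodic_initials F = {x 0 |x. isolated_periodic_solution F x}"

text \<open>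
  The order of vanishing is the index of the first nonvanishing derivative, and \<open>\<infinity>\<close>
  (the infimum of the empty set) if all derivatives vanish.
\<close>

definition vanishing_order :: "(real \<Rightarrow> real) \<Rightarrow> real \<Rightarrow> enat" where
  "vanishing_order f z = (INF k\<in>{k. (deriv ^^ k) f z \<noteq> 0}. enat k)"

definition periodic_multiplicity :: "(real \<Rightarrow> real \<Rightarrow> real) \<Rightarrow> real \<Rightarrow> enat" where
  "periodic_multiplicity F x0 = vanishing_order (displacement F) x0"

definition coeff_fun :: "nat \<Rightarrow> (nat \<Rightarrow> real) \<Rightarrow> real \<Rightarrow> real" where
  "coeff_fun m a x = (\<Sum>i=0..m. a i * x ^ i)"

definition trig_field ::
    "nat \<Rightarrow> (nat \<Rightarrow> real) \<Rightarrow> (nat \<Rightarrow> real) \<Rightarrow> (nat \<Rightarrow> real) \<Rightarrow> real \<Rightarrow> real \<Rightarrow> real" where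
  "trig_field m a b c t x =
     (\<Sum>i=0..m. (a i + b i * cos (2 * pi * t) + c i * sin (2 * pi * t)) * x ^ i)"

end

theory Submission
  imports Defs
begin

text \<open>
  Write \<open>S t x\<close> for the right-hand side and \<open>P x = (\<Prod>k. x - k)\<close> for the product over the nodes.
  Since \<open>f\<^sub>a\<^sup>2 = f\<^sub>b\<^sup>2 + f\<^sub>c\<^sup>2\<close> at a node, \<open>S t k\<close> has the sign of \<open>f\<^sub>a k\<close> for all \<open>t\<close>, so
  \<open>S t k / P' k\<close> has a sign \<open>\<rho>\<close> common to all nodes and times, and Lagrange interpolation gives
  \<open>S = P * G\<close> with \<open>G t x = \<alpha> m t + (\<Sum>k. w k t / (x - k))\<close>, \<open>\<rho> * w k t \<ge> 0\<close>.
  A periodic solution meeting a node is constant, so \<open>S t k = 0\<close> there for all \<open>t\<close>; let \<open>N\<close> be the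
  set of the other nodes. Off the nodes, \<open>G t (x t) = x' / P x\<close> integrates to 0 along a periodic
  solution. Let \<open>E\<close> be the set of initial values of all periodic solutions with \<open>\<integral> G t (x t) = 0\<close>. As
  \<open>\<rho> * G t\<close> decreases between the nodes in \<open>N\<close>, any two points of \<open>E\<close> are separated by a point
  of \<open>N\<close>; the sign of \<open>\<integral> \<alpha> m\<close> excludes one of the two unbounded components, and
  \<open>card E \<le> card N\<close>. Finally \<open>\<integral> S\<^sub>x\<close> and, if it vanishes, the second derivative of
  the return map show that a periodic solution has multiplicity at most 1, or 2 if it is a constant
  solution with initial value in \<open>E\<close>, so that the total is at most \<open>card E + card (K - N) \<le> m\<close>.
  If \<open>N = {}\<close> and \<open>\<integral> \<alpha> m = 0\<close>, every solution is periodic and none is isolated.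
\<close>

section \<open>Flow of a scalar equation\<close>

lemma has_derivative_integrating_factor:
  fixes d q r :: "real \<Rightarrow> real"
  assumes q: "continuous_on {a..b} q" and t: "t \<in> {a..b}"
    and d: "(d has_real_derivative q t * d t + r t) (at t within {a..b})"
  shows "((\<lambda>t. d t * exp (- integral {a..t} q)) has_real_derivative r t * exp (- integral {a..t} q))
    (at t within {a..b})"
  by (rule derivative_eq_intros d integral_has_real_derivative[OF q t] refl)+
    (simp add: algebra_simps)

lemma has_field_derivative_of_factorization:
  fixes f g :: "'a::real_normed_field \<Rightarrow> 'a"
  assumes "open U" "z \<in> U" and fg: "\<And>y. y \<in> U \<Longrightarrow> f y - f z = (y - z) * g y"
    and g: "continuous_on U g"
  shows "(f has_field_derivative g z) (at z)"
proof -
  have "(g \<longlongrightarrow> g z) (at z)"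
    using assms continuous_on_eq_continuous_at[of U g] by (auto simp: isCont_def)
  moreover have "eventually (\<lambda>y. g y = (f y - f z) / (y - z)) (at z)"
    using eventually_at_in_open'[OF assms(1,2)] eventually_neq_at_within[of z z UNIV]
    by eventually_elim (use fg in auto)
  ultimately show ?thesis
    unfolding has_field_derivative_iff by (rule Lim_transform_eventually)
qed

lemma vanishing_order_le:
  "(deriv ^^ k) f z \<noteq> 0 \<Longrightarrow> vanishing_order f z \<le> enat k"
  unfolding vanishing_order_def by (rule INF_lower) simp

lemma solution_DERIV:
  "ode_solution F x \<Longrightarrow> t \<in> {0..1} \<Longrightarrow> (x has_real_derivative F t (x t)) (at t within {0..1})"
  by (simp add: ode_solution_def)

lemma ode_solution_continuous: "ode_solution F x \<Longrightarrow> continuous_on {0..1} x"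
  unfolding ode_solution_def
  using DERIV_continuous continuous_on_eq_continuous_within by blast

locale divided_difference_field =
  fixes F :: "real \<Rightarrow> real \<Rightarrow> real" and Q :: "real \<Rightarrow> real \<Rightarrow> real \<Rightarrow> real"
  assumes continuous_field: "continuous_on UNIV (\<lambda>(t, x). F t x)"
    and continuous_quotient: "continuous_on UNIV (\<lambda>(t, x, y). Q t x y)"
    and field_diff: "F t y - F t x = (y - x) * Q t x y"
begin

lemma continuous_on_field [continuous_intros]:
  assumes "continuous_on S f" "continuous_on S g"
  shows "continuous_on S (\<lambda>s. F (f s) (g s))"
  using continuous_on_compose2[OF continuous_field continuous_on_Pair[OF assms]] by simp

lemma continuous_on_quotient [continuous_intros]:
  assumes "continuous_on S f" "continuous_on S g" "continuous_on S h"
  shows "continuous_on S (\<lambda>s. Q (f s) (g s) (h s))"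
  using continuous_on_compose2[OF continuous_quotient
      continuous_on_Pair[OF assms(1) continuous_on_Pair[OF assms(2,3)]]] by simp

lemma DERIV_field: "((\<lambda>y. F t y) has_real_derivative Q t x x) (at x)"
  by (rule has_field_derivative_of_factorization[of UNIV])
    (auto simp: field_diff intro!: continuous_intros)

lemma solution_diff:
  assumes x: "ode_solution F x" and y: "ode_solution F y" and t: "t \<in> {0..1}"
  shows "y t - x t = (y 0 - x 0) * exp (integral {0..t} (\<lambda>s. Q s (x s) (y s)))"
proof -
  define q where "q s = Q s (x s) (y s)" for s
  have q: "continuous_on {0..1} q"
    unfolding q_def by (intro continuous_intros ode_solution_continuous[OF x] ode_solution_continuous[OF y])
  have d: "((\<lambda>t. y t - x t) has_real_derivative q s * (y s - x s) + 0) (at s within {0..1})"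
    if "s \<in> {0..1}" for s
  proof -
    have "((\<lambda>t. y t - x t) has_real_derivative F s (y s) - F s (x s)) (at s within {0..1})"
      using x y that unfolding ode_solution_def by (intro DERIV_diff) auto
    then show ?thesis by (simp add: field_diff q_def mult.commute)
  qed
  have "\<exists>k. \<forall>s\<in>{0..1}. (y s - x s) * exp (- integral {0..s} q) = k"
    using has_derivative_integrating_factor[OF q, where r = "\<lambda>_. 0"] d
    by (intro has_field_derivative_zero_constant) auto
  then obtain k where k: "\<And>s. s \<in> {0..1} \<Longrightarrow> (y s - x s) * exp (- integral {0..s} q) = k"
    by blast
  from k[of t] k[of 0] t have "(y t - x t) * exp (- integral {0..t} q) = y 0 - x 0" by simp
  then have "y t - x t = (y 0 - x 0) / exp (- integral {0..t} q)" by (simp add: field_simps)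
  then show ?thesis by (simp add: exp_minus divide_inverse q_def[abs_def])
qed

lemma solution_unique:
  "ode_solution F x \<Longrightarrow> ode_solution F y \<Longrightarrow> x 0 = y 0 \<Longrightarrow> t \<in> {0..1} \<Longrightarrow> x t = y t"
  using solution_diff[of x y t] by simp

lemma return_map_eq:
  assumes "ode_solution F x"
  shows "return_map F (x 0) = x 1"
  unfolding return_map_def
proof (rule the_equality)
  show "\<exists>y. ode_solution F y \<and> y 0 = x 0 \<and> y 1 = x 1" using assms by blast
qed (use solution_unique[OF assms, where t = 1] in force)

lemma quotient_bounded_near:
  assumes cx: "continuous_on {0..1} x"
  shows "\<exists>L>0. \<forall>t u v. t \<in> {0..1} \<longrightarrow> \<bar>u\<bar> \<le> 1 \<longrightarrow> \<bar>v\<bar> \<le> 1 \<longrightarrow>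
    \<bar>Q t (x t + u) (x t + v)\<bar> \<le> L"
proof -
  define C where "C = (\<lambda>(t, u, v). (t, x t + u, x t + v)) ` ({0..1} \<times> {-1..1} \<times> {-1..1::real})"
  have "compact C"
    unfolding C_def
    by (intro compact_continuous_image compact_Times)
      (auto simp: case_prod_unfold intro!: continuous_intros continuous_on_compose2[OF cx])
  then have "bounded ((\<lambda>(t, u, v). Q t u v) ` C)"
    by (intro compact_imp_bounded compact_continuous_image
        continuous_on_subset[OF continuous_quotient]) auto
  then obtain L where L0: "L > 0" and L: "\<And>z. z \<in> (\<lambda>(t, u, v). Q t u v) ` C \<Longrightarrow> \<bar>z\<bar> \<le> L"
    unfolding bounded_pos by auto
  show ?thesis
  proof (intro exI[of _ L] conjI allI impI)
    fix t u v :: real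
    assume "t \<in> {0..1}" "\<bar>u\<bar> \<le> 1" "\<bar>v\<bar> \<le> 1"
    then have "(t, x t + u, x t + v) \<in> C"
      unfolding C_def by (intro image_eqI[of _ _ "(t, u, v)"]) auto
    then show "\<bar>Q t (x t + u) (x t + v)\<bar> \<le> L"
      by (intro L image_eqI[of _ _ "(t, x t + u, x t + v)"]) auto
  qed (rule L0)
qed

text \<open>The solution through \<open>y0\<close> is sought as \<open>t \<mapsto> x t + exp (K * t) * y t\<close>: with \<open>K\<close> twice the
  Lipschitz constant near \<open>x\<close>, the integral equation for \<open>y\<close> is a contraction by \<open>1/2\<close> of the
  ball of radius \<open>exp (- K)\<close>, on which \<open>exp (K * t) * y t\<close> never leaves \<open>[-1, 1]\<close>.\<close>

lemma local_existence:
  assumes xs: "ode_solution F x"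
  shows "\<exists>e>0. \<forall>y0. \<bar>y0 - x 0\<bar> < e \<longrightarrow>
    (\<exists>y. ode_solution F y \<and> y 0 = y0 \<and> (\<forall>t\<in>{0..1}. \<bar>y t - x t\<bar> \<le> 1))"
proof -
  note cx = ode_solution_continuous[OF xs]
  obtain L where "L > 0"
    and L: "\<And>t u v. t \<in> {0..1} \<Longrightarrow> \<bar>u\<bar> \<le> 1 \<Longrightarrow> \<bar>v\<bar> \<le> 1 \<Longrightarrow> \<bar>Q t (x t + u) (x t + v)\<bar> \<le> L"
    using quotient_bounded_near[OF cx] by blast
  have lip: "\<bar>F t (x t + v) - F t (x t + u)\<bar> \<le> L * \<bar>v - u\<bar>"
    if "t \<in> {0..1}" "\<bar>u\<bar> \<le> 1" "\<bar>v\<bar> \<le> 1" for t u v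
  proof -
    have "\<bar>v - u\<bar> * \<bar>Q t (x t + u) (x t + v)\<bar> \<le> \<bar>v - u\<bar> * L"
      by (intro mult_left_mono L that) auto
    then show ?thesis by (simp add: field_diff abs_mult mult.commute[of L])
  qed
  define K where "K = 2 * L"
  define e where "e = exp (- K)"
  define c where "c t = max 0 (min 1 t)" for t :: real
  have K: "K > 0" and e: "e > 0" using \<open>L > 0\<close> by (auto simp: K_def e_def)
  have c: "c t \<in> {0..1}" for t by (auto simp: c_def)
  have cont_c: "continuous_on UNIV c" unfolding c_def by (intro continuous_intros)
  have exp_int: "((\<lambda>s. exp (K * s)) has_integral (exp (K * t) - 1) / K) {0..t}" if "t \<in> {0..1}" for t
  proof -
    have "((\<lambda>s. exp (K * s)) has_integral (exp (K * t) / K - exp (K * 0) / K)) {0..t}"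
      using that K
      by (intro fundamental_theorem_of_calculus)
        (auto simp: has_real_derivative_iff_has_vector_derivative[symmetric]
          intro!: derivative_eq_intros)
    then show ?thesis by (simp add: diff_divide_distrib)
  qed
  define g where "g y s = F s (x s + exp (K * s) * y s) - F s (x s)" for y :: "real \<Rightarrow> real" and s
  have cont_g: "continuous_on {0..1} (g y)" if "continuous_on UNIV y" for y
    unfolding g_def
    by (intro continuous_intros cx continuous_on_subset[OF that]) auto
  have small: "\<bar>exp (K * s) * u\<bar> \<le> 1" if "\<bar>u\<bar> \<le> e" "s \<in> {0..1}" for u s
  proof -
    have "\<bar>exp (K * s) * u\<bar> \<le> exp K * e"
      unfolding abs_mult using that K by (intro mult_mono) (auto simp: mult_left_le)
    then show ?thesis by (simp add: e_def exp_minus)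
  qed
  have g_diff: "\<bar>integral {0..t} (g y) - integral {0..t} (g z)\<bar> \<le> exp (K * t) * (D / 2)"
    if y: "continuous_on UNIV y" "\<And>s. \<bar>y s\<bar> \<le> e" and z: "continuous_on UNIV z" "\<And>s. \<bar>z s\<bar> \<le> e"
      and D: "\<And>s. \<bar>y s - z s\<bar> \<le> D" and t: "t \<in> {0..1}" for y z D t
  proof -
    have int: "g y integrable_on {0..t}" "g z integrable_on {0..t}"
      using t by (auto intro!: integrable_continuous_interval continuous_on_subset[OF cont_g] y z)
    have bd: "\<bar>g y s - g z s\<bar> \<le> exp (K * s) * (L * D)" if "s \<in> {0..t}" for s
    proof -
      from that t have s: "s \<in> {0..1}" by auto
      have "\<bar>g y s - g z s\<bar> \<le> L * \<bar>exp (K * s) * y s - exp (K * s) * z s\<bar>"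
        using lip[OF s small[OF z(2) s] small[OF y(2) s]] by (simp add: g_def)
      also have "\<dots> = L * exp (K * s) * \<bar>y s - z s\<bar>"
        by (simp add: abs_mult right_diff_distrib[symmetric])
      also have "\<dots> \<le> L * exp (K * s) * D"
        using D[of s] \<open>L > 0\<close> by (intro mult_left_mono) auto
      finally show ?thesis by (simp add: mult_ac)
    qed
    have ei: "((\<lambda>s. exp (K * s) * (L * D)) has_integral (exp (K * t) - 1) / K * (L * D)) {0..t}"
      by (intro has_integral_mult_left exp_int t)
    have "\<bar>integral {0..t} (g y) - integral {0..t} (g z)\<bar> = norm (integral {0..t} (\<lambda>s. g y s - g z s))"
      using int by (simp add: integral_diff)
    also have "\<dots> \<le> integral {0..t} (\<lambda>s. exp (K * s) * (L * D))"
      using bd int ei by (intro integral_norm_bound_integral integrable_diff) auto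
    also have "\<dots> = (exp (K * t) - 1) * (D / 2)"
      unfolding integral_unique[OF ei] using \<open>L > 0\<close> by (simp add: K_def)
    also have "\<dots> \<le> exp (K * t) * (D / 2)"
      using D[of 0] by (intro mult_right_mono) auto
    finally show ?thesis .
  qed
  show ?thesis
  proof (intro exI[of _ "e / 2"] conjI allI impI)
    fix y0 assume y0: "\<bar>y0 - x 0\<bar> < e / 2"
    define d where "d = y0 - x 0"
    define T where "T y t = exp (- K * c t) * (d + integral {0..c t} (g y))" for y t
    have cont_T: "continuous_on UNIV (T y)" if "continuous_on UNIV y" for y
    proof -
      have "continuous_on {0..1} (\<lambda>u. exp (- K * u) * (d + integral {0..u} (g y)))"
        by (intro continuous_intros indefinite_integral_continuous_1 integrable_continuous_interval
            cont_g that)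
      then show ?thesis
        unfolding T_def by (rule continuous_on_compose2[OF _ cont_c]) (use c in auto)
    qed
    have T_bd: "\<bar>T y t\<bar> \<le> e" if "continuous_on UNIV y" "\<And>s. \<bar>y s\<bar> \<le> e" for y t
    proof -
      have "\<bar>integral {0..c t} (g y) - integral {0..c t} (g (\<lambda>_. 0))\<bar> \<le> exp (K * c t) * (e / 2)"
        using that e c by (intro g_diff) auto
      moreover have "g (\<lambda>_. 0) = (\<lambda>_. 0)" by (auto simp: g_def)
      ultimately have "\<bar>integral {0..c t} (g y)\<bar> \<le> exp (K * c t) * (e / 2)" by simp
      moreover have "\<bar>d\<bar> \<le> exp (K * c t) * (e / 2)"
      proof -
        have "1 * (e / 2) \<le> exp (K * c t) * (e / 2)"
          using c[of t] K e by (intro mult_right_mono) auto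
        then show ?thesis using y0 by (simp add: d_def)
      qed
      ultimately have "\<bar>d + integral {0..c t} (g y)\<bar> \<le> exp (K * c t) * e" by linarith
      then have "exp (- K * c t) * \<bar>d + integral {0..c t} (g y)\<bar> \<le> exp (- K * c t) * (exp (K * c t) * e)"
        by (intro mult_left_mono) auto
      also have "\<dots> = e" by (simp add: exp_minus)
      finally show ?thesis by (simp add: T_def abs_mult)
    qed
    define B where "B = cball (0 :: real \<Rightarrow>\<^sub>C real) e"
    define TB where "TB y = Bcontfun (T (apply_bcontfun y))" for y
    have B: "\<bar>apply_bcontfun y s\<bar> \<le> e" if "y \<in> B" for y s
      using norm_bounded[of y s] that by (simp add: B_def)
    have TB: "apply_bcontfun (TB y) = T (apply_bcontfun y)" if "y \<in> B" for y
      unfolding TB_def using that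
      by (intro Bcontfun_inverse bcontfun_normI[where b = e] cont_T) (auto intro!: T_bd B)
    have "\<exists>!y. y \<in> B \<and> TB y = y"
    proof (rule Banach_fix[where c = "1/2"])
      show "complete B" unfolding B_def by (simp add: complete_eq_closed)
      show "B \<noteq> {}" using e by (auto simp: B_def)
      show "TB ` B \<subseteq> B"
      proof safe
        fix y assume "y \<in> B"
        then have "norm (TB y) \<le> e" by (intro norm_bound) (auto simp: TB intro!: T_bd B)
        then show "TB y \<in> B" by (simp add: B_def)
      qed
      fix y z assume yz: "y \<in> B" "z \<in> B"
      show "dist (TB y) (TB z) \<le> 1 / 2 * dist y z"
      proof (rule dist_bound)
        fix t
        have "\<bar>integral {0..c t} (g y) - integral {0..c t} (g z)\<bar> \<le> exp (K * c t) * (dist y z / 2)"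
          using yz c dist_bounded[of y _ z] by (intro g_diff B) (auto simp: dist_real_def)
        then have "exp (- K * c t) * \<bar>integral {0..c t} (g y) - integral {0..c t} (g z)\<bar>
            \<le> exp (- K * c t) * (exp (K * c t) * (dist y z / 2))"
          by (intro mult_left_mono) auto
        also have "\<dots> = dist y z / 2" by (simp add: exp_minus)
        finally show "dist (apply_bcontfun (TB y) t) (apply_bcontfun (TB z) t) \<le> 1 / 2 * dist y z"
          by (simp add: TB yz T_def dist_real_def abs_mult right_diff_distrib[symmetric])
      qed
    qed auto
    then obtain y where yB: "y \<in> B" and "TB y = y" by blast
    then have fix_y: "apply_bcontfun y t = T y t" for t using TB[OF yB] by simp
    define u where "u t = x t + exp (K * t) * y t" for t
    have u: "u t = x t + d + integral {0..t} (g y)" if "t \<in> {0..1}" for t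
    proof -
      have "c t = t" using that by (auto simp: c_def)
      then show ?thesis by (simp add: u_def fix_y T_def exp_minus)
    qed
    show "\<exists>y. ode_solution F y \<and> y 0 = y0 \<and> (\<forall>t\<in>{0..1}. \<bar>y t - x t\<bar> \<le> 1)"
    proof (intro exI[of _ u] conjI ballI)
      show "ode_solution F u"
        unfolding ode_solution_def
      proof
        fix t :: real assume t: "t \<in> {0..1}"
        have "((\<lambda>t. x t + d + integral {0..t} (g y)) has_real_derivative F t (x t) + 0 + g y t)
          (at t within {0..1})"
          using t xs by (intro DERIV_add integral_has_real_derivative cont_g)
            (auto simp: ode_solution_def)
        then have "((\<lambda>t. x t + d + integral {0..t} (g y)) has_real_derivative F t (u t))
          (at t within {0..1})"
          by (simp add: g_def u_def)
        then show "(u has_real_derivative F t (u t)) (at t within {0..1})"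
          by (rule has_field_derivative_transform_within[where d = 1]) (use t in \<open>auto simp: u\<close>)
      qed
      show "u 0 = y0" using u[of 0] by (simp add: d_def)
      fix t :: real assume "t \<in> {0..1}"
      then show "\<bar>u t - x t\<bar> \<le> 1"
        unfolding u_def using small[OF B[OF yB]] by simp
    qed
  qed (use e in auto)
qed

lemma local_flow:
  assumes xs: "ode_solution F x"
  obtains e X where "e > 0"
    and "\<And>y. y \<in> ball (x 0) e \<Longrightarrow> ode_solution F (X y)"
    and "\<And>y. y \<in> ball (x 0) e \<Longrightarrow> X y 0 = y"
    and "continuous_on (ball (x 0) e \<times> {0..1}) (\<lambda>(y, t). X y t)"
proof -
  note cx = ode_solution_continuous[OF xs]
  obtain e where e: "e > 0" and "\<forall>y. \<bar>y - x 0\<bar> < e \<longrightarrow>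
    (\<exists>z. ode_solution F z \<and> z 0 = y \<and> (\<forall>t\<in>{0..1}. \<bar>z t - x t\<bar> \<le> 1))"
    using local_existence[OF xs] by blast
  then have "\<forall>y\<in>ball (x 0) e.
    \<exists>z. ode_solution F z \<and> z 0 = y \<and> (\<forall>t\<in>{0..1}. \<bar>z t - x t\<bar> \<le> 1)"
    by (auto simp: dist_real_def abs_minus_commute)
  then obtain X where X: "\<And>y. y \<in> ball (x 0) e \<Longrightarrow> ode_solution F (X y)"
      "\<And>y. y \<in> ball (x 0) e \<Longrightarrow> X y 0 = y"
    and near: "\<And>y t. y \<in> ball (x 0) e \<Longrightarrow> t \<in> {0..1} \<Longrightarrow> \<bar>X y t - x t\<bar> \<le> 1"
    by metis
  obtain L where "L > 0"
    and L: "\<And>t u v. t \<in> {0..1} \<Longrightarrow> \<bar>u\<bar> \<le> 1 \<Longrightarrow> \<bar>v\<bar> \<le> 1 \<Longrightarrow> \<bar>Q t (x t + u) (x t + v)\<bar> \<le> L"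
    using quotient_bounded_near[OF cx] by blast
  have lip: "\<bar>X z t - X y t\<bar> \<le> \<bar>z - y\<bar> * exp L"
    if yz: "y \<in> ball (x 0) e" "z \<in> ball (x 0) e" and t: "t \<in> {0..1}" for y z t
  proof -
    define q where "q s = Q s (X y s) (X z s)" for s
    have q: "continuous_on {0..t} q"
      unfolding q_def using t
      by (intro continuous_intros continuous_on_subset[OF ode_solution_continuous[OF X(1)]] yz) auto
    have q_le: "q s \<le> L" if "s \<in> {0..t}" for s
      using L[of s "X y s - x s" "X z s - x s"] that t near[OF yz(1), of s] near[OF yz(2), of s]
      by (simp add: q_def)
    have "integral {0..t} q \<le> integral {0..t} (\<lambda>_. L)"
      by (intro integral_le integrable_continuous_interval q q_le) auto
    also have "\<dots> \<le> L" using t \<open>L > 0\<close> by (simp add: mult_left_le_one_le)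
    finally have "integral {0..t} q \<le> L" .
    then show ?thesis
      using solution_diff[OF X(1)[OF yz(1)] X(1)[OF yz(2)] t] X(2)[OF yz(1)] X(2)[OF yz(2)]
      by (simp add: abs_mult q_def[abs_def] mult_left_mono)
  qed
  have "continuous_on (ball (x 0) e \<times> {0..1}) (\<lambda>(y, t). X y t)"
    unfolding continuous_on_def
  proof
    fix p assume "p \<in> ball (x 0) e \<times> {0..1::real}"
    then obtain y t where p: "p = (y, t)" and y: "y \<in> ball (x 0) e" and t: "t \<in> {0..1}" by auto
    let ?A = "at p within ball (x 0) e \<times> {0..1}"
    have "((\<lambda>p. X y (snd p)) \<longlongrightarrow> X y (snd p)) ?A"
      using continuous_on_compose2[OF ode_solution_continuous[OF X(1)[OF y]]
          continuous_on_snd[OF continuous_on_id], of "ball (x 0) e \<times> {0..1}"] y t p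
      by (auto simp: continuous_on_def)
    moreover have "((\<lambda>p. X (fst p) (snd p) - X y (snd p)) \<longlongrightarrow> 0) ?A"
    proof (rule Lim_null_comparison)
      show "\<forall>\<^sub>F q in ?A. norm (X (fst q) (snd q) - X y (snd q)) \<le> \<bar>fst q - y\<bar> * exp L"
        unfolding eventually_at_filter using lip[OF y] by (auto intro!: always_eventually)
      have "((\<lambda>q. \<bar>fst q - y\<bar> * exp L) \<longlongrightarrow> \<bar>fst p - y\<bar> * exp L) ?A"
        by (intro tendsto_intros)
      then show "((\<lambda>q. \<bar>fst q - y\<bar> * exp L) \<longlongrightarrow> 0) ?A" by (simp add: p)
    qed
    ultimately have "((\<lambda>q. X y (snd q) + (X (fst q) (snd q) - X y (snd q))) \<longlongrightarrow> X y (snd p) + 0) ?A"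
      by (rule tendsto_add)
    then show "((\<lambda>(y, t). X y t) \<longlongrightarrow> (case p of (y, t) \<Rightarrow> X y t)) ?A"
      by (simp add: case_prod_unfold p)
  qed
  then show ?thesis using that[OF e] X by blast
qed

lemma return_map_DERIV:
  assumes xs: "ode_solution F x"
  shows "(return_map F has_real_derivative exp (integral {0..1} (\<lambda>t. Q t (x t) (x t)))) (at (x 0))"
proof -
  obtain e X where e: "e > 0" and X: "\<And>y. y \<in> ball (x 0) e \<Longrightarrow> ode_solution F (X y)"
      "\<And>y. y \<in> ball (x 0) e \<Longrightarrow> X y 0 = y"
    and cX: "continuous_on (ball (x 0) e \<times> {0..1}) (\<lambda>(y, t). X y t)"
    using local_flow[OF xs] by metis
  define g where "g y = exp (integral {0..1} (\<lambda>t. Q t (x t) (X y t)))" for y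
  have "(return_map F has_real_derivative g (x 0)) (at (x 0))"
  proof (rule has_field_derivative_of_factorization)
    fix y assume y: "y \<in> ball (x 0) e"
    show "return_map F y - return_map F (x 0) = (y - x 0) * g y"
      using solution_diff[OF xs X(1)[OF y], of 1] return_map_eq[OF xs] return_map_eq[OF X(1)[OF y]] X(2)[OF y]
      by (simp add: g_def)
  next
    have "continuous_on (ball (x 0) e \<times> {0..1}) (\<lambda>p. Q (snd p) (x (snd p)) (X (fst p) (snd p)))"
      using cX by (intro continuous_intros continuous_on_compose2[OF ode_solution_continuous[OF xs]])
        (auto simp: case_prod_unfold)
    then show "continuous_on (ball (x 0) e) g"
      unfolding g_def using integral_continuous_on_param[of "ball (x 0) e" 0 1 "\<lambda>y t. Q t (x t) (X y t)"]
      by (intro continuous_on_exp) (simp add: case_prod_unfold)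
  qed (use e in auto)
  moreover have "X (x 0) t = x t" if "t \<in> {0..1}" for t
    using solution_unique[OF X(1)[of "x 0"] xs _ that] X(2)[of "x 0"] e by simp
  then have "g (x 0) = exp (integral {0..1} (\<lambda>t. Q t (x t) (x t)))"
    unfolding g_def by (intro arg_cong[where f = exp] integral_cong) simp
  ultimately show ?thesis by simp
qed

lemma displacement_DERIV:
  assumes "ode_solution F x"
  shows "(displacement F has_real_derivative exp (integral {0..1} (\<lambda>t. Q t (x t) (x t))) - 1) (at (x 0))"
  unfolding displacement_def[abs_def]
  by (intro DERIV_diff return_map_DERIV[OF assms] DERIV_ident)

lemma multiplicity_le_1:
  assumes "ode_solution F x" and "integral {0..1} (\<lambda>t. Q t (x t) (x t)) \<noteq> 0"
  shows "periodic_multiplicity F (x 0) \<le> 1"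
  using vanishing_order_le[of 1 "displacement F" "x 0"] DERIV_imp_deriv[OF displacement_DERIV[OF assms(1)]] assms(2)
  by (simp add: periodic_multiplicity_def one_enat_def)

end

locale twice_divided_difference_field = divided_difference_field +
  fixes Q1 :: "real \<Rightarrow> real \<Rightarrow> real \<Rightarrow> real"
  assumes derivative_field: "divided_difference_field (\<lambda>t x. Q t x x) Q1"
begin

interpretation D: divided_difference_field "\<lambda>t x. Q t x x" Q1
  by (rule derivative_field)

lemma multiplicity_le_2:
  assumes xs: "ode_solution F x" and "integral {0..1} (\<lambda>t. Q t (x t) (x t)) = 0"
    and nz: "integral {0..1} (\<lambda>t. Q1 t (x t) (x t) * exp (integral {0..t} (\<lambda>s. Q s (x s) (x s)))) \<noteq> 0"
  shows "periodic_multiplicity F (x 0) \<le> 2"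
proof -
  note cx = ode_solution_continuous[OF xs]
  obtain e X where e: "e > 0" and X: "\<And>y. y \<in> ball (x 0) e \<Longrightarrow> ode_solution F (X y)"
      "\<And>y. y \<in> ball (x 0) e \<Longrightarrow> X y 0 = y"
    and cX: "continuous_on (ball (x 0) e \<times> {0..1}) (\<lambda>(y, t). X y t)"
    using local_flow[OF xs] by metis
  define U where "U = ball (x 0) e"
  have x0: "x 0 \<in> U" using e by (simp add: U_def)
  have Xx: "X (x 0) t = x t" if "t \<in> {0..1}" for t
    using solution_unique[OF X(1)[of "x 0"] xs _ that] X(2)[of "x 0"] e by simp
  define J where "J y = integral {0..1} (\<lambda>t. Q t (X y t) (X y t))" for y
  define I where "I y t = integral {0..t} (\<lambda>s. Q s (x s) (X y s))" for y t
  define g where "g y = integral {0..1} (\<lambda>t. Q1 t (x t) (X y t) * exp (I y t))" for y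
  have cont_X: "continuous_on {0..1} (X y)" if "y \<in> U" for y
    using that by (intro ode_solution_continuous[OF X(1)]) (simp add: U_def)
  have cont_q: "continuous_on (U \<times> {0..1}) (\<lambda>p. Q (snd p) (x (snd p)) (X (fst p) (snd p)))"
    using cX by (intro continuous_intros continuous_on_compose2[OF cx])
      (auto simp: U_def case_prod_unfold)
  have rescale: "I y t = t * integral {0..1} (\<lambda>r. Q (t * r) (x (t * r)) (X y (t * r)))"
    if "y \<in> U" "t \<in> {0..1}" for y t
  proof -
    have "((\<lambda>r. t *\<^sub>R Q (t * r) (x (t * r)) (X y (t * r))) has_integral
        integral {t * 0..t * 1} (\<lambda>s. Q s (x s) (X y s))) {0..1}"
      by (rule has_integral_substitution[where c = 0 and d = 1])
        (use that in \<open>auto intro!: derivative_eq_intros continuous_intros cont_X cx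
          simp: mult_le_one\<close>)
    then show ?thesis by (simp add: I_def integral_unique flip: integral_mult_right)
  qed
  have "continuous_on ((U \<times> {0..1}) \<times> {0..1})
    (\<lambda>z. Q (snd (fst z) * snd z) (x (snd (fst z) * snd z)) (X (fst (fst z)) (snd (fst z) * snd z)))"
    by (rule continuous_on_compose2[OF cont_q, of _ "\<lambda>z. (fst (fst z), snd (fst z) * snd z)", simplified])
      (auto intro!: continuous_intros mult_le_one)
  then have "continuous_on (U \<times> {0..1}) (\<lambda>p. integral {0..1}
      (\<lambda>r. Q (snd p * r) (x (snd p * r)) (X (fst p) (snd p * r))))"
    using integral_continuous_on_param[of "U \<times> {0..1}" 0 1
        "\<lambda>p r. Q (snd p * r) (x (snd p * r)) (X (fst p) (snd p * r))"]
    by (simp add: case_prod_unfold)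
  then have "continuous_on (U \<times> {0..1}) (\<lambda>p. snd p * integral {0..1}
      (\<lambda>r. Q (snd p * r) (x (snd p * r)) (X (fst p) (snd p * r))))"
    by (intro continuous_intros)
  then have cont_I: "continuous_on (U \<times> {0..1}) (\<lambda>p. I (fst p) (snd p))"
    by (rule continuous_on_eq) (auto simp: rescale)
  have "continuous_on (U \<times> {0..1})
      (\<lambda>p. Q1 (snd p) (x (snd p)) (X (fst p) (snd p)) * exp (I (fst p) (snd p)))"
    using cX by (intro continuous_intros D.continuous_on_quotient cont_I continuous_on_compose2[OF cx])
      (auto simp: U_def case_prod_unfold)
  then have cont_g: "continuous_on U g"
    unfolding g_def
    using integral_continuous_on_param[of U 0 1 "\<lambda>y t. Q1 t (x t) (X y t) * exp (I y t)"]
    by (simp add: case_prod_unfold)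
  have "(J has_real_derivative g (x 0)) (at (x 0))"
  proof (rule has_field_derivative_of_factorization[OF _ x0 _ cont_g])
    fix y assume y: "y \<in> U"
    have diff: "Q t (X y t) (X y t) - Q t (X (x 0) t) (X (x 0) t) =
        (y - x 0) * (Q1 t (x t) (X y t) * exp (I y t))" if t: "t \<in> {0..1}" for t
      using D.field_diff[of t "X y t" "x t"] solution_diff[OF xs X(1) t, of y] X(2)[of y] y Xx[OF t]
      by (simp add: U_def I_def)
    have "J y - J (x 0) = integral {0..1} (\<lambda>t. Q t (X y t) (X y t) - Q t (X (x 0) t) (X (x 0) t))"
      unfolding J_def
      by (intro integral_diff[symmetric] integrable_continuous_interval continuous_intros cont_X x0 y)
    also have "\<dots> = integral {0..1} (\<lambda>t. (y - x 0) * (Q1 t (x t) (X y t) * exp (I y t)))"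
      by (intro integral_cong diff)
    finally show "J y - J (x 0) = (y - x 0) * g y" by (simp add: g_def)
  qed (simp add: U_def)
  moreover have "J (x 0) = integral {0..1} (\<lambda>t. Q t (x t) (x t))"
    unfolding J_def by (intro integral_cong) (simp add: Xx)
  ultimately have "((\<lambda>y. exp (J y) - 1) has_real_derivative g (x 0)) (at (x 0))"
    using assms(2) by (auto intro!: derivative_eq_intros)
  moreover have "deriv (displacement F) y = exp (J y) - 1" if "y \<in> U" for y
    using DERIV_imp_deriv[OF displacement_DERIV[OF X(1)[of y]]] X(2)[of y] that
    by (simp add: U_def J_def)
  then have "\<forall>\<^sub>F y in nhds (x 0). deriv (displacement F) y = exp (J y) - 1"
    using x0 by (intro eventually_nhds_in_open[THEN eventually_mono, of U]) (auto simp: U_def)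
  ultimately have "deriv (deriv (displacement F)) (x 0) = g (x 0)"
    by (simp add: deriv_cong_ev DERIV_imp_deriv)
  moreover have "g (x 0) = integral {0..1} (\<lambda>t. Q1 t (x t) (x t) *
      exp (integral {0..t} (\<lambda>s. Q s (x s) (x s))))"
    unfolding g_def I_def
    by (intro integral_cong arg_cong2[where f = "(*)"] arg_cong[where f = exp]) (auto simp: Xx)
  ultimately have "(deriv ^^ 2) (displacement F) (x 0) \<noteq> 0"
    using nz by (simp add: numeral_2_eq_2)
  from vanishing_order_le[OF this] show ?thesis
    by (simp add: periodic_multiplicity_def numeral_eq_enat)
qed

end

text \<open>\<open>s * (x t - k)\<close> times an integrating factor is nondecreasing, so it can vanish somewhere and
  have equal signs at 0 and 1 only if it vanishes identically.\<close>

lemma (in divided_difference_field) periodic_barrier: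
  assumes per: "periodic_solution F x" and "s \<noteq> 0"
    and sign: "\<And>t. t \<in> {0..1} \<Longrightarrow> s * F t k \<ge> 0"
    and t0: "t0 \<in> {0..1}" "x t0 = k" and t: "t \<in> {0..1}"
  shows "x t = k"
proof -
  have xs: "ode_solution F x" and x01: "x 0 = x 1"
    using per by (auto simp: periodic_solution_def)
  define q where "q t = Q t k (x t)" for t
  have q: "continuous_on {0..1} q"
    unfolding q_def by (intro continuous_intros ode_solution_continuous[OF xs])
  define h where "h t = s * (x t - k) * exp (- integral {0..t} q)" for t
  have dh: "(h has_real_derivative s * F u k * exp (- integral {0..u} q)) (at u within {0..1})"
    if u: "u \<in> {0..1}" for u
    unfolding h_def
  proof (rule has_derivative_integrating_factor[OF q u])
    have "((\<lambda>t. s * (x t - k)) has_real_derivative s * F u (x u)) (at u within {0..1})"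
      using xs u by (auto simp: ode_solution_def intro!: derivative_eq_intros)
    moreover have "s * F u (x u) = q u * (s * (x u - k)) + s * F u k"
      using arg_cong[OF field_diff[of u "x u" k], of "(*) s"] by (simp add: q_def algebra_simps)
    ultimately show "((\<lambda>t. s * (x t - k)) has_real_derivative q u * (s * (x u - k)) + s * F u k)
        (at u within {0..1})" by simp
  qed
  have mono: "h u \<le> h v" if "u \<in> {0..1}" "v \<in> {0..1}" "u \<le> v" for u v
  proof -
    have "\<exists>w\<in>{u..v}. h v - h u = (v - u) * (s * F w k * exp (- integral {0..w} q))"
    proof (rule mvt_very_simple[OF that(3)])
      fix w assume "u \<le> w" "w \<le> v"
      then have "(h has_real_derivative s * F w k * exp (- integral {0..w} q)) (at w within {u..v})"
        using that by (intro has_field_derivative_subset[OF dh]) auto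
      then show "(h has_derivative (\<lambda>d. d * (s * F w k * exp (- integral {0..w} q)))) (at w within {u..v})"
        by (simp add: has_field_derivative_def mult_commute_abs)
    qed
    then obtain w where w: "w \<in> {u..v}" "h v - h u = (v - u) * (s * F w k * exp (- integral {0..w} q))"
      by blast
    have "(v - u) * (s * F w k * exp (- integral {0..w} q)) \<ge> 0"
      using w(1) that by (intro mult_nonneg_nonneg[OF _ mult_nonneg_nonneg[OF sign]]) auto
    with w show ?thesis by simp
  qed
  have zero: "h u = 0 \<longleftrightarrow> x u = k" for u using \<open>s \<noteq> 0\<close> by (simp add: h_def)
  have "h 0 \<le> h t0" "h t0 \<le> h 1" using t0 by (auto intro!: mono)
  moreover have "h t0 = 0" using t0 zero by simp
  ultimately have "h 0 \<le> 0" "0 \<le> h 1" by auto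
  then have "s * (x 0 - k) \<le> 0" "s * (x 1 - k) \<ge> 0"
    by (auto simp: h_def zero_le_mult_iff mult_le_0_iff)
  then have "s * (x 0 - k) = 0" using x01 by auto
  then have "h 0 = 0" "h 1 = 0" using x01 by (auto simp: h_def)
  moreover have "h 0 \<le> h t" "h t \<le> h 1" using t by (auto intro!: mono)
  ultimately show ?thesis using zero[of t] by auto
qed

lemma connected_avoids_point:
  fixes x :: "'a::topological_space \<Rightarrow> real"
  assumes "connected S" "continuous_on S x" and "\<And>t. t \<in> S \<Longrightarrow> x t \<noteq> k" and "s \<in> S" "t \<in> S"
  shows "x t < k \<longleftrightarrow> x s < k"
proof -
  have "k \<notin> x ` S" using assms(3) by auto
  then show ?thesis
    using connectedD_interval[OF connected_continuous_image[OF assms(2,1)], of "x t" "x s" k]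
      connectedD_interval[OF connected_continuous_image[OF assms(2,1)], of "x s" "x t" k] assms(4,5)
      assms(3)[of s] assms(3)[of t]
    by (metis image_eqI less_eq_real_def linorder_not_less)
qed

lemma integral_positive:
  fixes f :: "real \<Rightarrow> real"
  assumes "continuous_on {a..b} f" "a < b" "\<And>t. t \<in> {a..b} \<Longrightarrow> f t \<ge> 0" "t0 \<in> {a..b}" "f t0 \<noteq> 0"
  shows "integral {a..b} f > 0"
  using integral_eq_0_iff[OF assms(1,2,3)] assms(4,5)
    integral_nonneg[OF integrable_continuous_interval[OF assms(1)] assms(3)]
  by (metis order_le_less)

lemma orbit_integral:
  fixes x x' f :: "real \<Rightarrow> real"
  assumes "a \<le> b" and dx: "\<And>t. t \<in> {a..b} \<Longrightarrow> (x has_real_derivative x' t) (at t within {a..b})"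
    and f: "continuous_on (x ` {a..b}) f"
  obtains V where "\<And>u. u \<in> x ` {a..b} \<Longrightarrow> (V has_real_derivative f u) (at u within x ` {a..b})"
    and "((\<lambda>t. f (x t) * x' t) has_integral V (x b) - V (x a)) {a..b}"
proof -
  have "continuous_on {a..b} x" using dx DERIV_continuous_on by blast
  then obtain c d where cd: "x ` {a..b} = {c..d}"
    using continuous_image_closed_interval[OF \<open>a \<le> b\<close>] by blast
  obtain V where V: "\<And>u. u \<in> {c..d} \<Longrightarrow> (V has_real_derivative f u) (at u within {c..d})"
    using antiderivative_continuous[of c d f] f unfolding cd has_real_derivative_iff_has_vector_derivative
    by metis
  have "((\<lambda>t. f (x t) * x' t) has_integral (V \<circ> x) b - (V \<circ> x) a) {a..b}"
  proof (rule fundamental_theorem_of_calculus[OF \<open>a \<le> b\<close>])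
    fix t assume t: "t \<in> {a..b}"
    then have "(V has_real_derivative f (x t)) (at (x t) within x ` {a..b})"
      unfolding cd by (intro V) (use cd in auto)
    from DERIV_image_chain[OF this dx[OF t]]
    show "(V \<circ> x has_vector_derivative f (x t) * x' t) (at t within {a..b})"
      by (simp add: has_real_derivative_iff_has_vector_derivative)
  qed
  then show ?thesis using that[of V] V cd by simp
qed

section \<open>Polynomial fields and interpolation\<close>

definition poly_field :: "nat \<Rightarrow> (nat \<Rightarrow> real \<Rightarrow> real) \<Rightarrow> real \<Rightarrow> real \<Rightarrow> real" where
  "poly_field m \<alpha> t x = (\<Sum>i=0..m. \<alpha> i t * x ^ i)"

definition poly_quotient :: "nat \<Rightarrow> (nat \<Rightarrow> real \<Rightarrow> real) \<Rightarrow> real \<Rightarrow> real \<Rightarrow> real \<Rightarrow> real" where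
  "poly_quotient m \<alpha> t x y = (\<Sum>i=0..m. \<alpha> i t * (\<Sum>j<i. x ^ (i - Suc j) * y ^ j))"

definition deriv_coeff :: "nat \<Rightarrow> (nat \<Rightarrow> real \<Rightarrow> real) \<Rightarrow> nat \<Rightarrow> real \<Rightarrow> real" where
  "deriv_coeff m \<alpha> i t = (if i < m then real (Suc i) * \<alpha> (Suc i) t else 0)"

lemma divided_difference_poly_field:
  assumes "\<And>i. continuous_on UNIV (\<alpha> i)"
  shows "divided_difference_field (poly_field m \<alpha>) (poly_quotient m \<alpha>)"
proof
  have \<alpha>: "continuous_on S (\<lambda>p. \<alpha> i (f p))" if "continuous_on S f" for i S and f :: "'b::topological_space \<Rightarrow> real"
    using continuous_on_compose2[OF assms that] by simp
  show "continuous_on UNIV (\<lambda>(t, x). poly_field m \<alpha> t x)"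
    unfolding poly_field_def case_prod_unfold by (intro continuous_intros \<alpha>)
  show "continuous_on UNIV (\<lambda>(t, x, y). poly_quotient m \<alpha> t x y)"
    unfolding poly_quotient_def case_prod_unfold by (intro continuous_intros \<alpha>)
  fix t x y
  have "poly_field m \<alpha> t y - poly_field m \<alpha> t x = (\<Sum>i=0..m. \<alpha> i t * (y ^ i - x ^ i))"
    by (simp add: poly_field_def sum_subtractf right_diff_distrib)
  also have "\<dots> = (y - x) * poly_quotient m \<alpha> t x y"
    by (simp add: poly_quotient_def sum_distrib_left power_diff_sumr2 mult_ac)
  finally show "poly_field m \<alpha> t y - poly_field m \<alpha> t x = (y - x) * poly_quotient m \<alpha> t x y" .
qed

lemma poly_quotient_diagonal:
  "poly_quotient m \<alpha> t x x = poly_field m (deriv_coeff m \<alpha>) t x"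
proof -
  have "poly_quotient m \<alpha> t x x = (\<Sum>i=0..m. \<alpha> i t * (real i * x ^ (i - 1)))"
    unfolding poly_quotient_def
  proof (intro sum.cong refl arg_cong2[where f = "(*)"])
    fix i
    have "(\<Sum>j<i. x ^ (i - Suc j) * x ^ j) = (\<Sum>j<i. x ^ (i - 1))"
      by (intro sum.cong refl) (simp flip: power_add)
    then show "(\<Sum>j<i. x ^ (i - Suc j) * x ^ j) = real i * x ^ (i - 1)" by simp
  qed
  also have "\<dots> = (\<Sum>i<m. real (Suc i) * \<alpha> (Suc i) t * x ^ i)"
    by (simp add: sum.atLeast0_atMost_Suc_shift atLeast0AtMost lessThan_Suc_atMost[symmetric] sum.lessThan_Suc_shift mult_ac del: sum.lessThan_Suc)
  also have "\<dots> = (\<Sum>i=0..m. deriv_coeff m \<alpha> i t * x ^ i)"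
    by (simp add: atLeast0AtMost lessThan_Suc_atMost[symmetric] deriv_coeff_def)
  finally show ?thesis by (simp add: poly_field_def)
qed

lemma twice_divided_difference_poly_field:
  assumes "\<And>i. continuous_on UNIV (\<alpha> i)"
  shows "twice_divided_difference_field (poly_field m \<alpha>) (poly_quotient m \<alpha>)
    (poly_quotient m (deriv_coeff m \<alpha>))"
proof -
  have "continuous_on UNIV (deriv_coeff m \<alpha> i)" for i
    unfolding deriv_coeff_def by (cases "i < m") (auto intro!: continuous_intros assms)
  then show ?thesis
    unfolding twice_divided_difference_field_def twice_divided_difference_field_axioms_def
      poly_quotient_diagonal
    by (intro conjI divided_difference_poly_field assms)
qed

definition node_weight :: "real set \<Rightarrow> real \<Rightarrow> real" where
  "node_weight K k = (\<Prod>j\<in>K - {k}. k - j)"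

lemma node_weight_nonzero: "finite K \<Longrightarrow> node_weight K k \<noteq> 0"
  by (simp add: node_weight_def)

lemma lagrange_interpolation_monic:
  assumes K: "finite K" and deg: "degree p \<le> card K"
  shows "poly p x = coeff p (card K) * (\<Prod>k\<in>K. x - k)
    + (\<Sum>k\<in>K. poly p k / node_weight K k * (\<Prod>j\<in>K - {k}. x - j))"
proof -
  define P where "P J = (\<Prod>j\<in>J. [:- j, 1:])" for J :: "real set"
  have poly_P: "poly (P J) y = (\<Prod>j\<in>J. y - j)" for J y
    by (simp add: P_def poly_prod)
  have deg_P: "degree (P J) = card J" if "finite J" for J
    using that unfolding P_def by (subst degree_prod_eq_sum_degree) auto
  have monic: "lead_coeff (P J) = 1" for J
    by (simp add: P_def lead_coeff_prod)
  define q where "q = smult (coeff p (card K)) (P K)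
    + (\<Sum>k\<in>K. smult (poly p k / node_weight K k) (P (K - {k})))"
  have roots: "poly (p - q) k = 0" if "k \<in> K" for k
  proof -
    have "(\<Sum>j\<in>K. poly p j / node_weight K j * (\<Prod>i\<in>K - {j}. k - i)) =
        (\<Sum>j\<in>K. if j = k then poly p k else 0)"
      using K that node_weight_nonzero[OF K]
      by (intro sum.cong refl) (auto simp: node_weight_def)
    moreover have "(\<Prod>j\<in>K. k - j) = 0" using K that by simp
    ultimately show ?thesis
      using K that by (simp add: q_def poly_P poly_sum)
  qed
  have "p - q = 0"
  proof (rule ccontr)
    assume nz: "p - q \<noteq> 0"
    have "K \<subseteq> {y. poly (p - q) y = 0}" using roots by blast
    then have "card K \<le> card {y. poly (p - q) y = 0}"
      by (intro card_mono poly_roots_finite nz)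
    also have "\<dots> \<le> degree (p - q)" by (rule card_poly_roots_bound[OF nz])
    finally have le: "card K \<le> degree (p - q)" .
    have small: "degree (smult c (P (K - {k}))) < card K" if "k \<in> K" for k c
    proof -
      have "degree (smult c (P (K - {k}))) \<le> card (K - {k})"
        using deg_P[of "K - {k}"] K degree_smult_le by force
      also have "\<dots> < card K" using K that by (intro psubset_card_mono) auto
      finally show ?thesis .
    qed
    have "degree q \<le> card K"
      unfolding q_def using small K
      by (intro degree_add_le degree_sum_le) (auto intro: less_imp_le simp: deg_P)
    then have "degree (p - q) \<le> card K" using deg by (intro degree_diff_le) auto
    with le have eq: "degree (p - q) = card K" by simp
    have "coeff (P K) (card K) = 1" using monic[of K] deg_P[OF K] by simp
    moreover have "coeff (\<Sum>k\<in>K. smult (poly p k / node_weight K k) (P (K - {k}))) (card K) = 0"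
      unfolding coeff_sum by (intro sum.neutral ballI coeff_eq_0 small)
    ultimately have "coeff (p - q) (card K) = 0" by (simp add: q_def)
    with eq nz show False by (metis leading_coeff_0_iff)
  qed
  then have "poly p x = poly q x" by simp
  then show ?thesis by (simp add: q_def poly_P poly_sum)
qed

lemma separated_card_le:
  fixes E K :: "'a::linorder set"
  assumes K: "finite K"
    and sep: "\<And>x y. x \<in> E \<Longrightarrow> y \<in> E \<Longrightarrow> x < y \<Longrightarrow> \<exists>k\<in>K. x < k \<and> k < y"
    and one_sided: "(\<forall>x\<in>E. \<exists>k\<in>K. x < k) \<or> (\<forall>x\<in>E. \<exists>k\<in>K. k < x)"
  shows "finite E \<and> card E \<le> card K"
proof -
  have "\<exists>f. inj_on f E \<and> f ` E \<subseteq> K"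
    using one_sided
  proof
    assume *: "\<forall>x\<in>E. \<exists>k\<in>K. x < k"
    define f where "f x = Min {k\<in>K. x < k}" for x
    have "f x \<in> {k\<in>K. x < k}" if "x \<in> E" for x
      unfolding f_def by (rule Min_in) (use K * that in auto)
    then have f: "f x \<in> K \<and> x < f x" if "x \<in> E" for x
      using that by blast
    have "f x \<noteq> f y" if xy: "x \<in> E" "y \<in> E" "x < y" for x y
    proof -
      obtain k where "k \<in> K" "x < k" "k < y" using sep[OF xy] by blast
      then have "f x \<le> k" unfolding f_def by (intro Min_le) (auto simp: K)
      then show ?thesis using f[OF xy(2)] \<open>k < y\<close> by auto
    qed
    then have "inj_on f E" by (metis inj_onI linorder_neqE)
    then show ?thesis using f by blast
  next
    assume *: "\<forall>x\<in>E. \<exists>k\<in>K. k < x"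
    define f where "f x = Max {k\<in>K. k < x}" for x
    have "f x \<in> {k\<in>K. k < x}" if "x \<in> E" for x
      unfolding f_def by (rule Max_in) (use K * that in auto)
    then have f: "f x \<in> K \<and> f x < x" if "x \<in> E" for x
      using that by blast
    have "f x \<noteq> f y" if xy: "x \<in> E" "y \<in> E" "x < y" for x y
    proof -
      obtain k where "k \<in> K" "x < k" "k < y" using sep[OF xy] by blast
      then have "k \<le> f y" unfolding f_def by (intro Max_ge) (auto simp: K)
      then show ?thesis using f[OF xy(1)] \<open>x < k\<close> by auto
    qed
    then have "inj_on f E" by (metis inj_onI linorder_neqE)
    then show ?thesis using f by blast
  qed
  then show ?thesis using K by (meson card_inj_on_le inj_on_finite)
qed

section \<open>Fields with one-signed weights\<close>

locale one_signed_weights =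
  fixes m :: nat and \<alpha> :: "nat \<Rightarrow> real \<Rightarrow> real" and K :: "real set" and \<rho> :: real
  assumes continuous_coeff: "continuous_on UNIV (\<alpha> i)"
    and finite_nodes: "finite K" and card_nodes: "card K = m"
    and sign_nonzero: "\<rho> \<noteq> 0"
    and weight_sign: "k \<in> K \<Longrightarrow> t \<in> {0..1} \<Longrightarrow> \<rho> * (poly_field m \<alpha> t k / node_weight K k) \<ge> 0"
begin

abbreviation "S \<equiv> poly_field m \<alpha>"
abbreviation "Q \<equiv> poly_quotient m \<alpha>"
abbreviation "Q1 \<equiv> poly_quotient m (deriv_coeff m \<alpha>)"

sublocale twice_divided_difference_field S Q Q1
  by (intro twice_divided_difference_poly_field continuous_coeff)

sublocale D: divided_difference_field "\<lambda>t x. Q t x x" Q1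
  by (rule derivative_field)

definition "w k t = S t k / node_weight K k"
definition "W t x = (\<Sum>k\<in>K. w k t / (x - k))"
definition "G t x = \<alpha> m t + W t x"
definition "G1 t x = - (\<Sum>k\<in>K. w k t / (x - k)\<^sup>2)"
definition "P = (\<Prod>k\<in>K. [:- k, 1:])"
definition "N = {k\<in>K. \<exists>t\<in>{0..1}. S t k \<noteq> 0}"

lemma continuous_on_w: "continuous_on UNIV (w k)"
  unfolding w_def by (intro continuous_intros) (simp add: node_weight_nonzero finite_nodes)

lemma w_sign: "k \<in> K \<Longrightarrow> t \<in> {0..1} \<Longrightarrow> \<rho> * w k t \<ge> 0"
  using weight_sign by (simp add: w_def)

lemma w_zero: "k \<in> K - N \<Longrightarrow> t \<in> {0..1} \<Longrightarrow> w k t = 0"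
  by (auto simp: w_def N_def)

lemma w_nonzero: "k \<in> N \<Longrightarrow> \<exists>t\<in>{0..1}. w k t \<noteq> 0"
  by (auto simp: w_def N_def node_weight_nonzero finite_nodes)

lemma poly_P: "poly P x = (\<Prod>k\<in>K. x - k)"
  by (simp add: P_def poly_prod)

lemma poly_P_eq_0_iff: "poly P x = 0 \<longleftrightarrow> x \<in> K"
  using finite_nodes by (auto simp: poly_P)

lemma pderiv_P: "k \<in> K \<Longrightarrow> poly (pderiv P) k = node_weight K k"
  using finite_nodes
  by (simp add: P_def prod.remove[of K k] pderiv_mult pderiv_pCons poly_prod node_weight_def
      del: mult_pCons_left)

text \<open>At a node \<open>x = k\<close> with \<open>S t k = 0\<close> the term \<open>w k t / (x - k)\<close> is \<open>0 / 0 = 0\<close>, so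
  there \<open>G t\<close> is the partial fraction without that term; this makes \<open>G\<close> and \<open>G1\<close> smooth
  across invariant lines.\<close>

lemma field_factorization:
  assumes reg: "x \<in> K \<Longrightarrow> S t x = 0"
  shows "S t x = poly P x * G t x"
proof -
  define p where "p = (\<Sum>i=0..m. monom (\<alpha> i t) i)"
  have p: "poly p y = S t y" for y
    by (simp add: p_def poly_sum poly_monom poly_field_def)
  have deg: "degree p \<le> card K"
    unfolding p_def card_nodes by (intro degree_sum_le) (auto intro: order_trans[OF degree_monom_le])
  have "coeff p (card K) = \<alpha> m t"
    by (simp add: p_def coeff_sum card_nodes)
  moreover have "poly p k / node_weight K k * (\<Prod>j\<in>K - {k}. x - j) = poly P x * (w k t / (x - k))"
    if k: "k \<in> K" for k
  proof (cases "x = k")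
    case True
    then show ?thesis using reg k by (simp add: p)
  next
    case False
    then show ?thesis
      using finite_nodes k by (simp add: p poly_P w_def prod.remove[of K k])
  qed
  ultimately show ?thesis
    using lagrange_interpolation_monic[OF finite_nodes deg, of x]
    by (simp add: p G_def W_def poly_P[symmetric] distrib_left sum_distrib_left mult.commute)
qed

lemma DERIV_partial_fractions:
  assumes reg: "x \<in> K \<Longrightarrow> S t x = 0"
  shows "(G t has_real_derivative G1 t x) (at x)"
    and "(G1 t has_real_derivative (\<Sum>k\<in>K. 2 * w k t / (x - k) ^ 3)) (at x)"
proof -
  have *: "w k t = 0 \<or> x \<noteq> k" if "k \<in> K" for k
    using reg that by (auto simp: w_def)
  have "((\<lambda>x. w k t / (x - k)) has_real_derivative - (w k t / (x - k)\<^sup>2)) (at x)"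
    if "k \<in> K" for k
  proof (cases "w k t = 0")
    case False
    then have "x - k \<noteq> 0" using *[OF that] by simp
    then show ?thesis by (auto intro!: derivative_eq_intros simp: power2_eq_square)
  qed simp
  then have "((\<lambda>x. \<alpha> m t + (\<Sum>k\<in>K. w k t / (x - k))) has_real_derivative
      0 + (\<Sum>k\<in>K. - (w k t / (x - k)\<^sup>2))) (at x)"
    by (intro DERIV_add DERIV_const DERIV_sum)
  then show "(G t has_real_derivative G1 t x) (at x)"
    by (simp add: G_def[abs_def] W_def G1_def sum_negf)
  have "((\<lambda>x. - (w k t / (x - k)\<^sup>2)) has_real_derivative 2 * w k t / (x - k) ^ 3) (at x)"
    if "k \<in> K" for k
  proof (cases "w k t = 0")
    case False
    then have "x - k \<noteq> 0" using *[OF that] by simp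
    then show ?thesis
      by (auto intro!: derivative_eq_intros simp: power2_eq_square power3_eq_cube divide_simps)
  qed simp
  then show "(G1 t has_real_derivative (\<Sum>k\<in>K. 2 * w k t / (x - k) ^ 3)) (at x)"
    unfolding G1_def[abs_def] sum_negf[symmetric] by (intro DERIV_sum)
qed

lemma open_regular: "open {x. x \<in> K \<longrightarrow> S t x = 0}"
proof -
  have "{x. x \<in> K \<longrightarrow> S t x = 0} = - {x\<in>K. S t x \<noteq> 0}" by auto
  then show ?thesis using finite_nodes by (simp add: finite_imp_closed open_Compl)
qed

lemma derivative_factorization:
  assumes reg: "x \<in> K \<Longrightarrow> S t x = 0"
  shows "Q t x x = poly (pderiv P) x * G t x + poly P x * G1 t x"
proof -
  have "((\<lambda>x. poly P x * G t x) has_real_derivative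
      poly (pderiv P) x * G t x + poly P x * G1 t x) (at x)"
    by (auto intro!: derivative_eq_intros DERIV_partial_fractions poly_DERIV reg)
  then have "(S t has_real_derivative poly (pderiv P) x * G t x + poly P x * G1 t x) (at x)"
    by (rule has_field_derivative_transform_within_open[OF _ open_regular[of t]])
      (auto simp: reg field_factorization)
  with DERIV_field[of t x] show ?thesis by (rule DERIV_unique)
qed

lemma second_derivative_at_node:
  assumes k: "k \<in> K" and "S t k = 0"
  shows "Q1 t k k = poly (pderiv (pderiv P)) k * G t k + 2 * poly (pderiv P) k * G1 t k"
proof -
  have "((\<lambda>x. poly (pderiv P) x * G t x + poly P x * G1 t x) has_real_derivative
      poly (pderiv (pderiv P)) k * G t k + poly (pderiv P) k * G1 t k +
      (poly (pderiv P) k * G1 t k + poly P k * (\<Sum>j\<in>K. 2 * w j t / (k - j) ^ 3))) (at k)"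
    by (auto intro!: derivative_eq_intros DERIV_partial_fractions poly_DERIV assms)
  then have "((\<lambda>x. Q t x x) has_real_derivative
      poly (pderiv (pderiv P)) k * G t k + poly (pderiv P) k * G1 t k +
      (poly (pderiv P) k * G1 t k + poly P k * (\<Sum>j\<in>K. 2 * w j t / (k - j) ^ 3))) (at k)"
    by (rule has_field_derivative_transform_within_open[OF _ open_regular[of t]])
      (auto simp: assms derivative_factorization)
  from DERIV_unique[OF D.DERIV_field[of t k] this] show ?thesis
    using k poly_P_eq_0_iff[of k] by simp
qed

lemma continuous_on_weighted_sum:
  assumes "\<And>k. k \<in> N \<Longrightarrow> continuous_on {0..1} (h k)"
  shows "continuous_on {0..1} (\<lambda>t. \<Sum>k\<in>K. w k t * h k t)"
proof (rule continuous_on_sum)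
  fix k assume k: "k \<in> K"
  show "continuous_on {0..1} (\<lambda>t. w k t * h k t)"
  proof (cases "k \<in> N")
    case True
    then show ?thesis
      using continuous_on_subset[OF continuous_on_w] by (intro continuous_on_mult assms) auto
  next
    case False
    show ?thesis
      by (rule continuous_on_eq[OF continuous_on_const[of _ 0]]) (use False k w_zero in auto)
  qed
qed

lemma continuous_on_W:
  assumes "continuous_on {0..1} x" "\<And>k t. k \<in> N \<Longrightarrow> t \<in> {0..1} \<Longrightarrow> x t \<noteq> k"
  shows "continuous_on {0..1} (\<lambda>t. W t (x t))"
  unfolding W_def divide_inverse
  using assms by (intro continuous_on_weighted_sum continuous_intros) auto

lemma continuous_on_G:
  assumes "continuous_on {0..1} x" "\<And>k t. k \<in> N \<Longrightarrow> t \<in> {0..1} \<Longrightarrow> x t \<noteq> k"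
  shows "continuous_on {0..1} (\<lambda>t. G t (x t))"
  unfolding G_def
  by (intro continuous_intros continuous_on_W assms continuous_on_subset[OF continuous_coeff]) auto

lemma continuous_on_G1:
  assumes "continuous_on {0..1} x" "\<And>k t. k \<in> N \<Longrightarrow> t \<in> {0..1} \<Longrightarrow> x t \<noteq> k"
  shows "continuous_on {0..1} (\<lambda>t. G1 t (x t))"
  unfolding G1_def divide_inverse
  using assms by (intro continuous_on_minus continuous_on_weighted_sum continuous_intros) auto

lemma weighted_integral_positive:
  assumes cont: "\<And>k. k \<in> N \<Longrightarrow> continuous_on {0..1} (h k)"
    and pos: "\<And>k t. k \<in> N \<Longrightarrow> t \<in> {0..1} \<Longrightarrow> h k t > 0" and "N \<noteq> {}"
  shows "\<rho> * integral {0..1} (\<lambda>t. \<Sum>k\<in>K. w k t * h k t) > 0"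
proof -
  have nonneg: "\<rho> * (w k t * h k t) \<ge> 0" if "k \<in> K" "t \<in> {0..1}" for k t
    using w_sign[OF that] w_zero[of k t] pos[of k t] that
    by (cases "k \<in> N") (auto simp: mult.assoc[symmetric] less_imp_le)
  from \<open>N \<noteq> {}\<close> obtain k where k: "k \<in> N" by blast
  obtain t where t: "t \<in> {0..1}" "w k t \<noteq> 0" using w_nonzero[OF k] by blast
  have kK: "k \<in> K" using k by (simp add: N_def)
  have "\<rho> * (w k t * h k t) \<noteq> 0" using pos[OF k t(1)] t(2) sign_nonzero by simp
  then have "0 < \<rho> * (w k t * h k t)" using nonneg[OF kK t(1)] by linarith
  also have "\<dots> \<le> (\<Sum>k\<in>K. \<rho> * (w k t * h k t))"
    using finite_nodes kK nonneg t(1) by (intro member_le_sum) auto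
  finally have "(\<Sum>k\<in>K. \<rho> * (w k t * h k t)) \<noteq> 0" by simp
  then have "integral {0..1} (\<lambda>t. \<rho> * (\<Sum>k\<in>K. w k t * h k t)) > 0"
    using nonneg t(1)
    by (intro integral_positive continuous_intros continuous_on_weighted_sum cont)
      (auto simp: sum_distrib_left intro!: sum_nonneg)
  then show ?thesis by simp
qed

lemma periodic_meets_node:
  assumes per: "periodic_solution S x" and k: "k \<in> K" and t0: "t0 \<in> {0..1}" "x t0 = k"
  shows "\<And>t. t \<in> {0..1} \<Longrightarrow> x t = k" and "k \<notin> N"
proof -
  show const: "x t = k" if "t \<in> {0..1}" for t
  proof (rule periodic_barrier[OF per, of "\<rho> / node_weight K k"])
    show "\<rho> / node_weight K k \<noteq> 0" by (simp add: sign_nonzero node_weight_nonzero finite_nodes)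
    fix t :: real assume "t \<in> {0..1}"
    from weight_sign[OF k this] show "\<rho> / node_weight K k * S t k \<ge> 0" by simp
  qed (use t0 that in auto)
  have "S t k = 0" if t: "t \<in> {0..1}" for t
  proof -
    have "(x has_real_derivative S t k) (at t within {0..1})"
      using per t const[OF t] by (auto simp: periodic_solution_def ode_solution_def)
    then have "((\<lambda>_. k) has_real_derivative S t k) (at t within {0..1})"
      by (rule has_field_derivative_transform_within[where d = 1]) (use t const in auto)
    moreover have "((\<lambda>_. k) has_real_derivative 0) (at t within {0..1})" by simp
    ultimately show ?thesis
      using vector_derivative_unique_within_closed_interval[of 0 1 t "\<lambda>_. k"] t
      by (auto simp: has_real_derivative_iff_has_vector_derivative)
  qed
  then show "k \<notin> N" by (auto simp: N_def)
qed

lemma periodic_avoids_N: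
  "periodic_solution S x \<Longrightarrow> k \<in> N \<Longrightarrow> t \<in> {0..1} \<Longrightarrow> x t \<noteq> k"
  using periodic_meets_node(2)[of x k t] by (auto simp: N_def)

lemma periodic_avoids_nodes:
  "periodic_solution S x \<Longrightarrow> x 0 \<notin> K \<Longrightarrow> t \<in> {0..1} \<Longrightarrow> x t \<notin> K"
  using periodic_meets_node(1)[of x "x t" t 0] by auto

lemma periodic_side:
  assumes "periodic_solution S x" "k \<in> N" "t \<in> {0..1}"
  shows "x t < k \<longleftrightarrow> x 0 < k"
  using assms periodic_avoids_N[OF assms(1,2)]
  by (intro connected_avoids_point[of "{0..1}"] ode_solution_continuous) (auto simp: periodic_solution_def)

lemma node_solution:
  assumes "k \<in> K - N"
  shows "periodic_solution S (\<lambda>_. k)"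
  using assms by (auto simp: periodic_solution_def ode_solution_def N_def)

definition "E = {x 0 |x. periodic_solution S x \<and> integral {0..1} (\<lambda>t. G t (x t)) = 0}"

lemma off_node_integrals:
  assumes per: "periodic_solution S x" and x0: "x 0 \<notin> K"
  shows "((\<lambda>t. G t (x t)) has_integral 0) {0..1}"
    and "((\<lambda>t. poly (pderiv P) (x t) * G t (x t)) has_integral 0) {0..1}"
proof -
  have xs: "ode_solution S x" and x01: "x 1 = x 0"
    using per by (auto simp: periodic_solution_def)
  note off = periodic_avoids_nodes[OF per x0]
  have *: "((\<lambda>t. poly p (x t) * G t (x t)) has_integral 0) {0..1}" for p :: "real poly"
  proof -
    have f: "continuous_on (x ` {0..1}) (\<lambda>u. poly p u / poly P u)"
      using off by (intro continuous_intros) (auto simp: poly_P_eq_0_iff)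
    obtain V where "\<And>u. u \<in> x ` {0..1} \<Longrightarrow>
        (V has_real_derivative poly p u / poly P u) (at u within x ` {0..1})"
      and "((\<lambda>t. poly p (x t) / poly P (x t) * S t (x t)) has_integral V (x 1) - V (x 0)) {0..1}"
      using orbit_integral[OF zero_le_one solution_DERIV[OF xs] f] by blast
    then have "((\<lambda>t. poly p (x t) / poly P (x t) * S t (x t)) has_integral 0) {0..1}"
      by (simp add: x01)
    then show ?thesis
      by (rule has_integral_eq[rotated])
        (simp add: field_factorization[OF notE[OF off]] poly_P_eq_0_iff off)
  qed
  from *[of 1] show "((\<lambda>t. G t (x t)) has_integral 0) {0..1}" by simp
  from *[of "pderiv P"] show "((\<lambda>t. poly (pderiv P) (x t) * G t (x t)) has_integral 0) {0..1}" .
qed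

lemma multiplicity_off_nodes:
  assumes per: "periodic_solution S x" and x0: "x 0 \<notin> K" and "N \<noteq> {}"
  shows "periodic_multiplicity S (x 0) \<le> 1"
proof (rule multiplicity_le_1)
  show xs: "ode_solution S x" using per by (simp add: periodic_solution_def)
  note off = periodic_avoids_nodes[OF per x0] and cx = ode_solution_continuous[OF xs]
  define y where "y t = poly P (x t)" for t
  have cy: "continuous_on {0..1} y" unfolding y_def by (intro continuous_intros cx)
  have y_nz: "y t \<noteq> 0" if "t \<in> {0..1}" for t
    using off[OF that] by (simp add: y_def poly_P_eq_0_iff)
  have y_sign: "y 0 * y t > 0" if t: "t \<in> {0..1}" for t
  proof -
    have "y t < 0 \<longleftrightarrow> y 0 < 0"
      by (rule connected_avoids_point[of "{0..1}"]) (use cy y_nz t in auto)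
    moreover have "y 0 \<noteq> 0" "y t \<noteq> 0" using y_nz t by auto
    ultimately show ?thesis
      by (metis linorder_neqE_linordered_idom mult_neg_neg mult_pos_pos)
  qed
  have cG1: "continuous_on {0..1} (\<lambda>t. G1 t (x t))"
    using periodic_avoids_N[OF per] by (intro continuous_on_G1 cx) auto
  define h where "h k t = y 0 * y t * inverse ((x t - k)\<^sup>2)" for k t
  have "\<rho> * integral {0..1} (\<lambda>t. \<Sum>k\<in>K. w k t * h k t) > 0"
  proof (rule weighted_integral_positive[OF _ _ \<open>N \<noteq> {}\<close>])
    fix k assume k: "k \<in> N"
    show "continuous_on {0..1} (h k)"
      unfolding h_def using periodic_avoids_N[OF per k] by (intro continuous_intros cy cx) auto
    fix t :: real assume t: "t \<in> {0..1}"
    show "h k t > 0"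
      unfolding h_def using periodic_avoids_N[OF per k t] by (intro mult_pos_pos[OF y_sign[OF t]]) auto
  qed
  also have "(\<lambda>t. \<Sum>k\<in>K. w k t * h k t) = (\<lambda>t. - y 0 * (y t * G1 t (x t)))"
    by (simp add: h_def G1_def sum_distrib_left sum_negf divide_inverse mult_ac fun_eq_iff)
  finally have "integral {0..1} (\<lambda>t. y t * G1 t (x t)) \<noteq> 0" by auto
  moreover have "integral {0..1} (\<lambda>t. Q t (x t) (x t)) = integral {0..1} (\<lambda>t. y t * G1 t (x t))"
  proof -
    have "((\<lambda>t. poly (pderiv P) (x t) * G t (x t) + y t * G1 t (x t)) has_integral
        0 + integral {0..1} (\<lambda>t. y t * G1 t (x t))) {0..1}"
      by (intro has_integral_add off_node_integrals[OF per x0] integrable_integral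
          integrable_continuous_interval continuous_on_mult cy cG1)
    then have "integral {0..1} (\<lambda>t. poly (pderiv P) (x t) * G t (x t) + y t * G1 t (x t)) =
        integral {0..1} (\<lambda>t. y t * G1 t (x t))"
      by (simp add: integral_unique)
    moreover have "integral {0..1} (\<lambda>t. Q t (x t) (x t)) =
        integral {0..1} (\<lambda>t. poly (pderiv P) (x t) * G t (x t) + y t * G1 t (x t))"
      unfolding y_def using off by (intro integral_cong derivative_factorization) blast
    ultimately show ?thesis by simp
  qed
  ultimately show "integral {0..1} (\<lambda>t. Q t (x t) (x t)) \<noteq> 0" by simp
qed

lemma node_derivative:
  assumes "k \<in> K - N" "t \<in> {0..1}"
  shows "Q t k k = node_weight K k * G t k"
  using assms by (subst derivative_factorization) (auto simp: N_def poly_P_eq_0_iff pderiv_P)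

lemma integral_node_derivative:
  assumes "k \<in> K - N"
  shows "integral {0..1} (\<lambda>t. Q t k k) = node_weight K k * integral {0..1} (\<lambda>t. G t k)"
proof -
  have "integral {0..1} (\<lambda>t. Q t k k) = integral {0..1} (\<lambda>t. node_weight K k * G t k)"
    by (intro integral_cong node_derivative assms)
  then show ?thesis by simp
qed

lemma multiplicity_node_le_1:
  assumes k: "k \<in> K - N" and "integral {0..1} (\<lambda>t. G t k) \<noteq> 0"
  shows "periodic_multiplicity S k \<le> 1"
  using multiplicity_le_1[of "\<lambda>_. k"] node_solution[OF k] assms(2)
  by (simp add: integral_node_derivative[OF k] periodic_solution_def node_weight_nonzero finite_nodes)

text \<open>With \<open>u t = exp (\<integral> s=0..t. S\<^sub>x s k)\<close>, the second derivative of the return map is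
  \<open>\<integral> (P'' * G + 2 * P' * G1) * u\<close> at \<open>k\<close>. Its first part is a multiple of \<open>u 1 - u 0 = 0\<close>, because
  \<open>u' = P' * G * u\<close>, and \<open>G1\<close> has a sign.\<close>

lemma multiplicity_node_le_2:
  assumes k: "k \<in> K - N" and G0: "integral {0..1} (\<lambda>t. G t k) = 0" and "N \<noteq> {}"
  shows "periodic_multiplicity S k \<le> 2"
proof -
  define c where "c = node_weight K k"
  define u where "u t = exp (integral {0..t} (\<lambda>s. Q s k k))" for t
  have c: "c \<noteq> 0" by (simp add: c_def node_weight_nonzero finite_nodes)
  have cQ: "continuous_on {0..1} (\<lambda>s. Q s k k)" by (intro continuous_intros)
  have Q0: "integral {0..1} (\<lambda>t. Q t k k) = 0"
    using integral_node_derivative[OF k] G0 by simp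
  have du: "(u has_real_derivative u t * Q t k k) (at t within {0..1})" if "t \<in> {0..1}" for t
    unfolding u_def
    by (rule derivative_eq_intros integral_has_real_derivative[OF cQ that] refl)+
  have cu: "continuous_on {0..1} u" by (rule DERIV_continuous_on[OF du])
  have off: "k \<noteq> j" if "j \<in> N" for j using k that by auto
  have "((\<lambda>t. u t * Q t k k) has_integral u 1 - u 0) {0..1}"
    using du by (intro fundamental_theorem_of_calculus)
      (auto simp: has_real_derivative_iff_has_vector_derivative)
  then have "((\<lambda>t. u t * Q t k k) has_integral 0) {0..1}" by (simp add: u_def Q0)
  then have "((\<lambda>t. poly (pderiv (pderiv P)) k / c * (u t * Q t k k)) has_integral
      poly (pderiv (pderiv P)) k / c * 0) {0..1}"
    by (rule has_integral_mult_right)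
  moreover have "((\<lambda>t. 2 * c * (G1 t k * u t)) has_integral
      2 * c * integral {0..1} (\<lambda>t. G1 t k * u t)) {0..1}"
    using off by (intro has_integral_mult_right integrable_integral integrable_continuous_interval
        continuous_on_mult cu continuous_on_G1) auto
  ultimately have "((\<lambda>t. poly (pderiv (pderiv P)) k / c * (u t * Q t k k) + 2 * c * (G1 t k * u t))
      has_integral poly (pderiv (pderiv P)) k / c * 0 + 2 * c * integral {0..1} (\<lambda>t. G1 t k * u t)) {0..1}"
    by (rule has_integral_add)
  then have "((\<lambda>t. poly (pderiv (pderiv P)) k / c * (u t * Q t k k) + 2 * c * (G1 t k * u t))
      has_integral 2 * c * integral {0..1} (\<lambda>t. G1 t k * u t)) {0..1}"
    by (simp only: mult_zero_right add_0_left)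
  moreover have "poly (pderiv (pderiv P)) k / c * (u t * Q t k k) + 2 * c * (G1 t k * u t) = Q1 t k k * u t"
    if t: "t \<in> {0..1}" for t
  proof -
    have "S t k = 0" using k t by (auto simp: N_def)
    then have "Q1 t k k = poly (pderiv (pderiv P)) k * G t k + 2 * c * G1 t k"
      using k by (simp add: second_derivative_at_node pderiv_P c_def)
    moreover have "Q t k k = c * G t k" using node_derivative[OF k t] by (simp add: c_def)
    ultimately show ?thesis using c by (simp add: algebra_simps)
  qed
  ultimately have "((\<lambda>t. Q1 t k k * u t) has_integral 2 * c * integral {0..1} (\<lambda>t. G1 t k * u t)) {0..1}"
    by (rule has_integral_eq[rotated])
  moreover have "\<rho> * integral {0..1} (\<lambda>t. \<Sum>j\<in>K. w j t * (u t * inverse ((k - j)\<^sup>2))) > 0"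
    using off by (intro weighted_integral_positive[OF _ _ \<open>N \<noteq> {}\<close>] continuous_intros cu)
      (auto simp: u_def)
  moreover have "(\<lambda>t. \<Sum>j\<in>K. w j t * (u t * inverse ((k - j)\<^sup>2))) = (\<lambda>t. - (G1 t k * u t))"
    by (simp add: G1_def sum_distrib_left divide_inverse mult_ac fun_eq_iff)
  ultimately have "integral {0..1} (\<lambda>t. Q1 t k k * u t) \<noteq> 0"
    using c by (auto simp: integral_unique)
  then show ?thesis
    using multiplicity_le_2[of "\<lambda>_. k"] node_solution[OF k] Q0
    by (simp add: u_def periodic_solution_def)
qed

lemma E_separated:
  assumes "y \<in> E" "z \<in> E" "y < z" "N \<noteq> {}"
  shows "\<exists>k\<in>N. y < k \<and> k < z"
proof (rule ccontr)
  assume none: "\<not> ?thesis"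
  obtain x where px: "periodic_solution S x" and y: "x 0 = y"
    and Gx: "integral {0..1} (\<lambda>t. G t (x t)) = 0"
    using assms(1) by (auto simp: E_def)
  obtain x' where px': "periodic_solution S x'" and z: "x' 0 = z"
    and Gx': "integral {0..1} (\<lambda>t. G t (x' t)) = 0"
    using assms(2) by (auto simp: E_def)
  have xs: "ode_solution S x" "ode_solution S x'"
    using px px' by (auto simp: periodic_solution_def)
  note cx = ode_solution_continuous[OF xs(1)] ode_solution_continuous[OF xs(2)]
  have less: "x t < x' t" if "t \<in> {0..1}" for t
  proof -
    have "x' t - x t > 0"
      unfolding solution_diff[OF xs that] using assms(3) by (simp add: y z)
    then show ?thesis by simp
  qed
  have same_side: "(x t - k) * (x' t - k) > 0" if "k \<in> N" "t \<in> {0..1}" for k t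
  proof -
    have "x t < k \<longleftrightarrow> x' t < k"
    proof -
      have "y \<noteq> k" "z \<noteq> k"
        using periodic_avoids_N[OF px that(1), of 0] periodic_avoids_N[OF px' that(1), of 0] y z by auto
      moreover have "\<not> (y < k \<and> k < z)" using none that(1) by blast
      ultimately have "y < k \<longleftrightarrow> z < k" using assms(3) by linarith
      then show ?thesis
        unfolding periodic_side[OF px that] periodic_side[OF px' that] y z .
    qed
    then show ?thesis
      using periodic_avoids_N[OF px that] periodic_avoids_N[OF px' that]
      by (auto simp: zero_less_mult_iff)
  qed
  define h where "h k t = inverse (x t - k) - inverse (x' t - k)" for k t
  have "\<rho> * integral {0..1} (\<lambda>t. \<Sum>k\<in>K. w k t * h k t) > 0"
  proof (rule weighted_integral_positive[OF _ _ \<open>N \<noteq> {}\<close>])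
    fix k assume k: "k \<in> N"
    show "continuous_on {0..1} (h k)"
      unfolding h_def using periodic_avoids_N[OF px k] periodic_avoids_N[OF px' k]
      by (intro continuous_intros cx) auto
    fix t :: real assume t: "t \<in> {0..1}"
    have "h k t = (x' t - x t) / ((x t - k) * (x' t - k))"
      using same_side[OF k t] by (auto simp: h_def divide_simps)
    then show "h k t > 0" using same_side[OF k t] less[OF t] by simp
  qed
  also have "(\<lambda>t. \<Sum>k\<in>K. w k t * h k t) = (\<lambda>t. G t (x t) - G t (x' t))"
    by (simp add: h_def G_def W_def right_diff_distrib sum_subtractf divide_inverse)
  also have "integral {0..1} (\<lambda>t. G t (x t) - G t (x' t)) = 0"
  proof (subst integral_diff)
    show "(\<lambda>t. G t (x t)) integrable_on {0..1}"
      by (intro integrable_continuous_interval continuous_on_G cx) (erule (1) periodic_avoids_N[OF px])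
    show "(\<lambda>t. G t (x' t)) integrable_on {0..1}"
      by (intro integrable_continuous_interval continuous_on_G cx) (erule (1) periodic_avoids_N[OF px'])
  qed (simp add: Gx Gx')
  finally show False by simp
qed

lemma E_not_beyond_N:
  assumes "y \<in> E" and nondeg: "N \<noteq> {} \<or> integral {0..1} (\<alpha> m) \<noteq> 0"
    and s: "s \<noteq> 0" and side: "\<And>k. k \<in> N \<Longrightarrow> s * (y - k) > 0"
  shows "\<rho> * s * integral {0..1} (\<alpha> m) < 0"
proof -
  obtain x where px: "periodic_solution S x" and y: "x 0 = y"
    and Gx: "integral {0..1} (\<lambda>t. G t (x t)) = 0"
    using assms(1) by (auto simp: E_def)
  have xs: "ode_solution S x" using px by (auto simp: periodic_solution_def)
  note cx = ode_solution_continuous[OF xs] and off = periodic_avoids_N[OF px]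
  have "integral {0..1} (\<lambda>t. G t (x t)) = integral {0..1} (\<alpha> m) + integral {0..1} (\<lambda>t. W t (x t))"
    unfolding G_def using off
    by (intro integral_add integrable_continuous_interval continuous_on_W cx
        continuous_on_subset[OF continuous_coeff]) auto
  then have eq: "integral {0..1} (\<alpha> m) = - integral {0..1} (\<lambda>t. W t (x t))" using Gx by simp
  have "N \<noteq> {}"
  proof
    assume "N = {}"
    then have "W t (x t) = 0" if "t \<in> {0..1}" for t
      unfolding W_def using w_zero that by (intro sum.neutral) auto
    then have "integral {0..1} (\<lambda>t. W t (x t)) = integral {0..1} (\<lambda>_::real. 0)"
      by (rule integral_cong)
    with eq nondeg \<open>N = {}\<close> show False by simp
  qed
  define h where "h k t = s * inverse (x t - k)" for k t
  have "\<rho> * integral {0..1} (\<lambda>t. \<Sum>k\<in>K. w k t * h k t) > 0"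
  proof (rule weighted_integral_positive[OF _ _ \<open>N \<noteq> {}\<close>])
    fix k assume k: "k \<in> N"
    show "continuous_on {0..1} (h k)"
      unfolding h_def using off[OF k] by (intro continuous_intros cx) auto
    fix t :: real assume t: "t \<in> {0..1}"
    show "h k t > 0"
      using side[OF k] periodic_side[OF px k t] off[OF k t] s
      by (auto simp: h_def y zero_less_mult_iff)
  qed
  also have "(\<lambda>t. \<Sum>k\<in>K. w k t * h k t) = (\<lambda>t. s * W t (x t))"
    by (simp add: h_def W_def sum_distrib_left divide_inverse mult_ac)
  finally show ?thesis by (simp add: eq mult.assoc)
qed

lemma card_E_le:
  assumes nondeg: "N \<noteq> {} \<or> integral {0..1} (\<alpha> m) \<noteq> 0"
  shows "finite E \<and> card E \<le> card N"
proof (rule separated_card_le)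
  show "finite N" using finite_nodes by (simp add: N_def)
  have ne: "y \<noteq> k" if "y \<in> E" "k \<in> N" for y k
    using that periodic_avoids_N[of _ k 0] by (auto simp: E_def)
  have beyond: "\<exists>k\<in>N. s * (y - k) < 0"
    if "y \<in> E" "s \<noteq> 0" "\<rho> * s * integral {0..1} (\<alpha> m) \<ge> 0" for y s
  proof (rule ccontr)
    assume none: "\<not> ?thesis"
    have "s * (y - k) > 0" if "k \<in> N" for k
    proof -
      have "s * (y - k) \<noteq> 0" using ne[OF \<open>y \<in> E\<close> \<open>k \<in> N\<close>] \<open>s \<noteq> 0\<close> by simp
      moreover have "\<not> s * (y - k) < 0" using none \<open>k \<in> N\<close> by blast
      ultimately show ?thesis by linarith
    qed
    with E_not_beyond_N[OF that(1) nondeg that(2)] that(3) show False by simp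
  qed
  show one_sided: "(\<forall>y\<in>E. \<exists>k\<in>N. y < k) \<or> (\<forall>y\<in>E. \<exists>k\<in>N. k < y)"
  proof (cases "\<rho> * integral {0..1} (\<alpha> m) \<ge> 0")
    case True
    then have "\<forall>y\<in>E. \<exists>k\<in>N. y < k" using beyond[of _ 1] by simp
    then show ?thesis ..
  next
    case False
    then have "\<forall>y\<in>E. \<exists>k\<in>N. k < y" using beyond[of _ "-1"] by simp
    then show ?thesis ..
  qed
  show "\<exists>k\<in>N. y < k \<and> k < z" if "y \<in> E" "z \<in> E" "y < z" for y z
  proof (rule E_separated[OF that])
    show "N \<noteq> {}" using one_sided that(1) by blast
  qed
qed

lemma no_isolated_if_degenerate:
  assumes "N = {}" and mean: "integral {0..1} (\<alpha> m) = 0"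
  shows "isolated_periodic_initials S = {}"
proof -
  have per: "x 1 = x 0" if xs: "ode_solution S x" for x
  proof (cases "x 0 \<in> K")
    case True
    then have "ode_solution S (\<lambda>_. x 0)"
      using node_solution[of "x 0"] assms(1) by (simp add: periodic_solution_def)
    from solution_unique[OF xs this, of 1] show ?thesis by simp
  next
    case False
    have off: "x t \<notin> K" if t: "t \<in> {0..1}" for t
    proof
      assume k: "x t \<in> K"
      then have "ode_solution S (\<lambda>_. x t)"
        using node_solution[of "x t"] assms(1) by (simp add: periodic_solution_def)
      from solution_diff[OF this xs t] False k show False by auto
    qed
    have f: "continuous_on (x ` {0..1}) (\<lambda>u. 1 / poly P u)"
      using off by (intro continuous_intros) (auto simp: poly_P_eq_0_iff)
    obtain V where V: "\<And>u. u \<in> x ` {0..1} \<Longrightarrow> (V has_real_derivative 1 / poly P u) (at u within x ` {0..1})"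
      and int: "((\<lambda>t. 1 / poly P (x t) * S t (x t)) has_integral V (x 1) - V (x 0)) {0..1}"
      using orbit_integral[OF zero_le_one solution_DERIV[OF xs] f] by blast
    have "integral {0..1} (\<lambda>t. 1 / poly P (x t) * S t (x t)) = integral {0..1} (\<alpha> m)"
    proof (rule integral_cong)
      fix t :: real assume t: "t \<in> {0..1}"
      have "W t (x t) = 0"
        unfolding W_def using w_zero t assms(1) by (intro sum.neutral) auto
      then show "1 / poly P (x t) * S t (x t) = \<alpha> m t"
        using off[OF t] field_factorization[of "x t" t] by (simp add: poly_P_eq_0_iff G_def)
    qed
    with int mean have Veq: "V (x 1) = V (x 0)" by (simp add: has_integral_iff)
    show ?thesis
    proof (rule ccontr)
      assume ne: "x 1 \<noteq> x 0"
      define a b where "a = min (x 0) (x 1)" and "b = max (x 0) (x 1)"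
      have ab: "a < b" "V a = V b" using ne Veq by (auto simp: a_def b_def min_def max_def)
      have "connected (x ` {0..1})"
        by (intro connected_continuous_image ode_solution_continuous[OF xs]) simp
      then have sub: "{a..b} \<subseteq> x ` {0..1}"
        by (rule connected_contains_Icc) (auto simp: a_def b_def min_def max_def)
      have "\<exists>u\<in>{a..b}. V b - V a = (b - a) * (1 / poly P u)"
      proof (rule mvt_very_simple)
        fix u assume "a \<le> u" "u \<le> b"
        then have "(V has_real_derivative 1 / poly P u) (at u within {a..b})"
          using sub by (intro has_field_derivative_subset[OF V]) auto
        then show "(V has_derivative (\<lambda>d. d * (1 / poly P u))) (at u within {a..b})"
          by (simp only: has_field_derivative_def mult_commute_abs)
      qed (use ab in simp)
      then obtain u where "u \<in> {a..b}" "poly P u = 0" using ab by auto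
      then show False using sub off by (auto simp: poly_P_eq_0_iff)
    qed
  qed
  have zero: "displacement S y = 0" if "y \<in> return_domain S" for y
    using that per return_map_eq by (auto simp: return_domain_def displacement_def)
  have "\<not> isolated_periodic_solution S x" for x
  proof
    assume iso: "isolated_periodic_solution S x"
    then have xs: "ode_solution S x"
      by (simp add: isolated_periodic_solution_def periodic_solution_def)
    obtain e where e: "e > 0" and dom: "\<And>y. \<bar>y - x 0\<bar> < e \<Longrightarrow> y \<in> return_domain S"
      using local_existence[OF xs] unfolding return_domain_def by blast
    obtain d where d: "d > 0"
      and only: "\<And>y. y \<in> return_domain S \<Longrightarrow> displacement S y = 0 \<Longrightarrow> dist (x 0) y < d \<Longrightarrow> y = x 0"
      using iso by (auto simp: isolated_periodic_solution_def isolated_in_dist_Ex_iff)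
    define y where "y = x 0 + min d e / 2"
    have "\<bar>y - x 0\<bar> < e" "dist (x 0) y < d" "y \<noteq> x 0"
      using d e by (auto simp: y_def dist_real_def min_def)
    then show False using only[of y] dom[of y] zero[of y] by blast
  qed
  then show ?thesis by (simp add: isolated_periodic_initials_def)
qed

theorem isolated_periodic_solutions_bound:
  "finite (isolated_periodic_initials S) \<and>
    (\<Sum>y\<in>isolated_periodic_initials S. periodic_multiplicity S y) \<le> enat m"
proof (cases "N = {} \<and> integral {0..1} (\<alpha> m) = 0")
  case True
  then show ?thesis by (simp add: no_isolated_if_degenerate)
next
  case False
  then have nondeg: "N \<noteq> {} \<or> integral {0..1} (\<alpha> m) \<noteq> 0" by blast
  note E = card_E_le[OF nondeg]
  define I where "I = isolated_periodic_initials S"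
  have N_nonempty: "N \<noteq> {}" if "y \<in> E" for y using E that by auto
  have node: "k \<in> K - N" if "periodic_solution S x" "x 0 = k" "k \<in> K" for x k
    using periodic_meets_node(2)[OF that(1,3), of 0] that by auto
  have I_sub: "I \<subseteq> E \<union> (K - N)"
  proof
    fix y assume "y \<in> I"
    then obtain x where px: "periodic_solution S x" and y: "x 0 = y"
      by (auto simp: I_def isolated_periodic_initials_def isolated_periodic_solution_def)
    show "y \<in> E \<union> (K - N)"
    proof (cases "y \<in> K")
      case False
      then have "integral {0..1} (\<lambda>t. G t (x t)) = 0"
        using off_node_integrals(1)[OF px] y by (auto simp: integral_unique)
      then show ?thesis using px y by (auto simp: E_def)
    qed (use node[OF px y] in blast)
  qed
  define n :: "real \<Rightarrow> nat" where "n y = of_bool (y \<in> E) + of_bool (y \<in> K - N)" for y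
  have mult: "periodic_multiplicity S y \<le> enat (n y)"
    if yI: "y \<in> I" for y
  proof -
    obtain x where px: "periodic_solution S x" and y: "x 0 = y"
      using yI by (auto simp: I_def isolated_periodic_initials_def isolated_periodic_solution_def)
    show ?thesis
    proof (cases "y \<in> K")
      case False
      then show ?thesis
        using I_sub yI multiplicity_off_nodes[OF px] y N_nonempty[of y]
        by (auto simp: one_enat_def n_def)
    next
      case True
      have k: "y \<in> K - N" by (rule node[OF px y True])
      show ?thesis
      proof (cases "integral {0..1} (\<lambda>t. G t y) = 0")
        case True
        then have "y \<in> E" using node_solution[OF k] by (auto simp: E_def intro!: exI[of _ "\<lambda>_. y"])
        then show ?thesis
          using multiplicity_node_le_2[OF k True N_nonempty] k by (simp add: numeral_eq_enat numeral_2_eq_2 n_def)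
      next
        case False
        then show ?thesis
          using order_trans[OF multiplicity_node_le_1[OF k False], of "enat _"] k
          by (auto simp: one_enat_def n_def)
      qed
    qed
  qed
  have fin: "finite I" using I_sub E finite_nodes by (meson finite_Diff finite_UnI finite_subset)
  have "(\<Sum>y\<in>I. periodic_multiplicity S y) \<le> (\<Sum>y\<in>I. enat (n y))"
    by (intro sum_mono mult)
  also have "\<dots> = enat (\<Sum>y\<in>I. n y)"
    by (simp flip: of_nat_eq_enat)
  also have "\<dots> \<le> enat m"
  proof -
    have "(\<Sum>y\<in>I. n y) = card (I \<inter> E) + card (I \<inter> (K - N))"
      using fin by (simp add: n_def sum.distrib sum_of_bool_eq Int_def)
    also have "\<dots> \<le> card E + card (K - N)"
      using E finite_nodes by (intro add_mono card_mono) auto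
    also have "\<dots> \<le> card N + card (K - N)" using E by simp
    also have "\<dots> = m"
      using card_nodes finite_nodes card_Diff_subset[of N K] card_mono[of K N] finite_subset[of N K]
      by (auto simp: N_def)
    finally show ?thesis by simp
  qed
  finally show ?thesis using fin by (simp add: I_def)
qed

end

lemma node_weight_strict_mono:
  fixes \<kappa> :: "nat \<Rightarrow> real"
  assumes mono: "strict_mono_on {1..m} \<kappa>" and i: "i \<in> {1..m}"
  shows "(-1) ^ (m - i) * node_weight (\<kappa> ` {1..m}) (\<kappa> i) > 0"
proof -
  have inj: "inj_on \<kappa> {1..m}" by (rule strict_mono_on_imp_inj_on[OF mono])
  then have "\<kappa> ` {1..m} - {\<kappa> i} = \<kappa> ` ({1..m} - {i})"
    using i inj_on_image_set_diff[of \<kappa> "{1..m}" "{1..m}" "{i}"] by simp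
  also have "{1..m} - {i} = {1..<i} \<union> {i<..m}" using i by auto
  finally have "node_weight (\<kappa> ` {1..m}) (\<kappa> i) = (\<Prod>k\<in>\<kappa> ` ({1..<i} \<union> {i<..m}). \<kappa> i - k)"
    by (simp only: node_weight_def)
  also have "\<dots> = (\<Prod>j\<in>{1..<i} \<union> {i<..m}. \<kappa> i - \<kappa> j)"
    using i by (subst prod.reindex) (auto intro!: inj_on_subset[OF inj])
  also have "\<dots> = (\<Prod>j\<in>{1..<i}. \<kappa> i - \<kappa> j) * (\<Prod>j\<in>{i<..m}. - (\<kappa> j - \<kappa> i))"
    by (subst prod.union_disjoint) auto
  also have "(\<Prod>j\<in>{i<..m}. - (\<kappa> j - \<kappa> i)) = (-1) ^ (m - i) * (\<Prod>j\<in>{i<..m}. \<kappa> j - \<kappa> i)"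
    by (subst prod_uminus) simp
  finally have "(-1) ^ (m - i) * node_weight (\<kappa> ` {1..m}) (\<kappa> i) =
      ((-1) ^ (m - i) * (-1) ^ (m - i)) * ((\<Prod>j\<in>{1..<i}. \<kappa> i - \<kappa> j) * (\<Prod>j\<in>{i<..m}. \<kappa> j - \<kappa> i))"
    by (simp add: mult_ac)
  also have "(-1::real) ^ (m - i) * (-1) ^ (m - i) = 1"
    by (simp add: power_mult_distrib[symmetric])
  finally show ?thesis
    using i by (auto intro!: mult_pos_pos prod_pos strict_mono_onD[OF mono])
qed

theorem corollary1p3:
  fixes m :: nat and a b c :: "nat \<Rightarrow> real" and \<kappa> :: "nat \<Rightarrow> real"
  assumes "m \<ge> 1"
    and "strict_mono_on {1..m} \<kappa>"
    and "\<And>i. i \<in> {1..m} \<Longrightarrow>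
      (coeff_fun m a (\<kappa> i))\<^sup>2 - (coeff_fun m b (\<kappa> i))\<^sup>2 - (coeff_fun m c (\<kappa> i))\<^sup>2 = 0"
    and "(\<forall>i\<in>{1..m}. (-1) ^ i * coeff_fun m a (\<kappa> i) \<ge> 0) \<or>
         (\<forall>i\<in>{1..m}. (-1) ^ i * coeff_fun m a (\<kappa> i) \<le> 0)"
  shows "finite (isolated_periodic_initials (trig_field m a b c)) \<and>
    (\<Sum>x0\<in>isolated_periodic_initials (trig_field m a b c).
       periodic_multiplicity (trig_field m a b c) x0) \<le> enat m"
proof -
  define \<alpha> where "\<alpha> i t = a i + b i * cos (2 * pi * t) + c i * sin (2 * pi * t)" for i t
  have S: "trig_field m a b c = poly_field m \<alpha>"
    by (simp add: fun_eq_iff trig_field_def poly_field_def \<alpha>_def)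
  obtain s :: real where s: "s \<noteq> 0" and sign: "\<And>i. i \<in> {1..m} \<Longrightarrow> s * (-1) ^ i * coeff_fun m a (\<kappa> i) \<ge> 0"
  proof (cases "\<forall>i\<in>{1..m}. (-1) ^ i * coeff_fun m a (\<kappa> i) \<ge> 0")
    case True
    then show ?thesis by (intro that[of 1]) auto
  next
    case False
    then show ?thesis using assms(4) by (intro that[of "-1"]) auto
  qed
  interpret one_signed_weights m \<alpha> "\<kappa> ` {1..m}" "s * (-1) ^ m"
  proof
    fix k t assume "k \<in> \<kappa> ` {1..m}"
    then obtain i where i: "i \<in> {1..m}" and k: "k = \<kappa> i" by blast
    define A B C where "A = coeff_fun m a k" and "B = coeff_fun m b k" and "C = coeff_fun m c k"
    define u v where "u = cos (2 * pi * t)" and "v = sin (2 * pi * t)"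
    have field: "poly_field m \<alpha> t k = A + (B * u + C * v)"
      unfolding poly_field_def \<alpha>_def A_def B_def C_def coeff_fun_def u_def[symmetric] v_def[symmetric]
      by (simp add: sum.distrib sum_distrib_left sum_distrib_right ring_distribs mult_ac)
    have ABC: "A\<^sup>2 = B\<^sup>2 + C\<^sup>2" using assms(3)[OF i] by (simp add: A_def B_def C_def k)
    have uv: "u\<^sup>2 + v\<^sup>2 = 1" by (simp add: u_def v_def)
    have "(B * u + C * v)\<^sup>2 + (B * v - C * u)\<^sup>2 = (B\<^sup>2 + C\<^sup>2) * (u\<^sup>2 + v\<^sup>2)"
      by (simp add: power2_eq_square algebra_simps)
    then have "(B * u + C * v)\<^sup>2 + (B * v - C * u)\<^sup>2 = A\<^sup>2" by (simp add: ABC uv)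
    then have "(B * u + C * v)\<^sup>2 \<le> A\<^sup>2"
      using zero_le_power2[of "B * v - C * u"] by linarith
    then have abs: "\<bar>B * u + C * v\<bar> \<le> \<bar>A\<bar>" by (simp add: abs_le_square_iff)
    define \<sigma> where "\<sigma> = s * (-1) ^ i"
    have "\<sigma> * A \<ge> 0" using sign[OF i] by (simp add: \<sigma>_def A_def k)
    moreover have "\<sigma> \<noteq> 0" using s by (simp add: \<sigma>_def)
    ultimately have "0 < \<sigma> \<and> 0 \<le> A \<or> \<sigma> < 0 \<and> A \<le> 0"
      by (simp add: zero_le_mult_iff) linarith
    then have "0 < \<sigma> \<and> 0 \<le> poly_field m \<alpha> t k \<or> \<sigma> < 0 \<and> poly_field m \<alpha> t k \<le> 0"
      unfolding field using abs by linarith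
    then have "\<sigma> * poly_field m \<alpha> t k \<ge> 0" by (auto simp: zero_le_mult_iff)
    moreover define e :: real where "e = (-1) ^ (m - i)"
    ultimately have "\<sigma> * poly_field m \<alpha> t k / (e * node_weight (\<kappa> ` {1..m}) k) \<ge> 0"
      using node_weight_strict_mono[OF assms(2) i] by (simp add: k)
    moreover have "s * (-1) ^ m = \<sigma> * e"
      using i by (simp add: \<sigma>_def e_def flip: power_add)
    moreover have "e = 1 \<or> e = - 1" by (cases "even (m - i)") (auto simp: e_def)
    ultimately show "s * (-1) ^ m * (poly_field m \<alpha> t k / node_weight (\<kappa> ` {1..m}) k) \<ge> 0"
      by auto
  next
    show "card (\<kappa> ` {1..m}) = m"
      using card_image[OF strict_mono_on_imp_inj_on[OF assms(2)]] by simp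
  qed (auto simp: s \<alpha>_def intro!: continuous_intros)
  show ?thesis
    unfolding S by (rule isolated_periodic_solutions_bound)
qed

end
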